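(* Let $i_1=1$, $i_2=a_1e_1+a_2e_2$, $i_3=b_1e_1+b_2e_2$ ($a_k,b_k\in\mathbb{C}$) be linearly independent over $\mathbb{R}$ in $\mathbb{H}(\mathbb{C})$, and assume $f_1(E_3)=f_2(E_3)=\mathbb{C}$. Let $\Omega\subset\mathbb{R}^3$ be a bounded domain with closed piecewise smooth boundary $\partial\Omega$ (oriented by the outward normal). Let $\Phi:\Omega_\zeta\to\mathbb{H}(\mathbb{C})$ be right-$G$-monogenic in $\Omega_\zeta$ and $\widehat\Phi:\Omega_\zeta\to\mathbb{H}(\mathbb{C})$ be left-$G$-monogenic in $\Omega_\zeta$, and suppose both mappings are continuous together with their first-order partial derivatives up to the boundary $\partial\Omega_\zeta$. Then $$\int_{\partial\Omega_\zeta}\sigma\,\Phi(\zeta)=\int_{\Omega_\zeta}(1+i_2^2+i_3^2)\,\Phi'(\zeta)\,dx\,dy\,dz$$ and $$\int_{\partial\Omega_\zeta}\widehat\Phi(\zeta)\,\sigma=\int_{\Omega_\zeta}\widehat\Phi'(\zeta)\,(1+i_2^2+i_3^2)\,dx\,dy\,dz .$$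
   Context: $\mathbb{H}(\mathbb{C})$ is the quaternion algebra over $\mathbb{C}$ with basis $1,I,J,K$ and rules $I^2=J^2=K^2=-1$, $IJ=-JI=K$, $JK=-KJ=I$, $KI=-IK=J$. With $i$ the complex imaginary unit, another basis is $$e_1=\tfrac12(1+iI),\quad e_2=\tfrac12(1-iI),\quad e_3=\tfrac12(iJ-K),\quad e_4=\tfrac12(iJ+K).$$ Its nonzero products are $e_1e_1=e_1$, $e_1e_3=e_3$, $e_2e_2=e_2$, $e_2e_4=e_4$, $e_3e_2=e_3$, $e_3e_4=e_1$, $e_4e_1=e_4$, $e_4e_3=e_2$, all other products $e_je_k$ are $0$, and $1=e_1+e_2$. $f_1,f_2:\mathbb{H}(\mathbb{C})\to\mathbb{C}$ are the $\mathbb{C}$-linear functionals with $f_1(e_1)=f_1(e_3)=1$, $f_1(e_2)=f_1(e_4)=0$, $f_2(e_2)=f_2(e_4)=1$, $f_2(e_1)=f_2(e_3)=0$. $E_3:=\{\zeta=xi_1+yi_2+zi_3: x,y,z\in\mathbb{R}\}$. For $S\subset\mathbb{R}^3$ put $S_\zeta:=\{xi_1+yi_2+zi_3:(x,y,z)\in S\}\subset E_3$; topological notions for $S_\zeta$ are those of $S$. A continuous mapping $\Phi:\Omega_\zeta\to\mathbb{H}(\mathbb{C})$ is right-$G$-monogenic in $\Omega_\zeta$ if for every $\zeta\in\Omega_\zeta$ there is $\Phi'(\zeta)\in\mathbb{H}(\mathbb{C})$ (the right Gateaux derivative) with $\lim_{\varepsilon\to0+}(\Phi(\zeta+\varepsilon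 h)-\Phi(\zeta))\varepsilon^{-1}=h\,\Phi'(\zeta)$ for all $h\in E_3$. A continuous mapping $\widehat\Phi$ is left-$G$-monogenic if for every $\zeta\in\Omega_\zeta$ there is $\widehat\Phi'(\zeta)\in\mathbb{H}(\mathbb{C})$ (the left Gateaux derivative) with $\lim_{\varepsilon\to0+}(\widehat\Phi(\zeta+\varepsilon h)-\widehat\Phi(\zeta))\varepsilon^{-1}=\widehat\Phi'(\zeta)\,h$ for all $h\in E_3$. For continuous $\Psi=\sum_{k=1}^4\Psi_ke_k$ with complex-valued $\Psi_k(x,y,z)$, the volume integral is $\int_{\Omega_\zeta}\Psi\,dx\,dy\,dz:=\sum_{k=1}^4e_k\int_\Omega\Psi_k\,dx\,dy\,dz$, and for a piecewise smooth surface $\Sigma\subset\mathbb{R}^3$ the surface integrals with the form $\sigma:=dy\,dz+dz\,dx\,i_2+dx\,dy\,i_3$ are $$\int_{\Sigma_\zeta}\sigma\,\Psi(\zeta):=\sum_{k=1}^4\Big(e_k\int_\Sigma\Psi_k\,dy\,dz+i_2e_k\int_\Sigma\Psi_k\,dz\,dx+i_3e_k\int_\Sigma\Psi_k\,dx\,dy\Big),$$ $$\int_{\Sigma_\zeta}\Psi(\zeta)\,\sigma:=\sum_{k=1}^4\Big(e_k\int_\Sigma\Psi_k\,dy\,dz+e_ki_2\int_\Sigma\Psi_k\,dz\,dx+e_ki_3\int_\Sigma\Psi_k\,dx\,dy\Big).$$ *)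

theory Defs
  imports "HOL-Analysis.Analysis"
begin

section \<open>Complex quaternions\<close>

text \<open>The four components are the coordinates with respect to the basis \<open>1, I, J, K\<close>.\<close>

datatype cquat = CQuat (q0: complex) (q1: complex) (q2: complex) (q3: complex)

instantiation cquat :: ring_1
begin

definition "0 = CQuat 0 0 0 0"
definition "1 = CQuat 1 0 0 0"
definition "x + y = CQuat (q0 x + q0 y) (q1 x + q1 y) (q2 x + q2 y) (q3 x + q3 y)"
definition "- x = CQuat (- q0 x) (- q1 x) (- q2 x) (- q3 x)"
definition "x - y = CQuat (q0 x - q0 y) (q1 x - q1 y) (q2 x - q2 y) (q3 x - q3 y)"
definition "x * y = CQuat
  (q0 x * q0 y - q1 x * q1 y - q2 x * q2 y - q3 x * q3 y)
  (q0 x * q1 y + q1 x * q0 y + q2 x * q3 y - q3 x * q2 y)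
  (q0 x * q2 y - q1 x * q3 y + q2 x * q0 y + q3 x * q1 y)
  (q0 x * q3 y + q1 x * q2 y - q2 x * q1 y + q3 x * q0 y)"

instance
  by standard
    (auto simp: zero_cquat_def one_cquat_def plus_cquat_def uminus_cquat_def minus_cquat_def
      times_cquat_def algebra_simps cquat.expand intro!: cquat.expand)

end

text \<open>The norm is the Euclidean one; it only serves to provide the topology.\<close>

instantiation cquat :: real_normed_vector
begin

definition "scaleR c x = CQuat (c *\<^sub>R q0 x) (c *\<^sub>R q1 x) (c *\<^sub>R q2 x) (c *\<^sub>R q3 x)"
definition "norm x = norm (q0 x, q1 x, q2 x, q3 x)"
definition "sgn (x::cquat) = inverse (norm x) *\<^sub>R x"
definition "dist (x::cquat) y = norm (x - y)"
definition "uniformity = (INF e\<in>{0 <..}. principal {(x::cquat, y). dist x y < e})"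
definition "open (U :: cquat set) \<longleftrightarrow> (\<forall>x\<in>U. eventually (\<lambda>(x', y). x' = x \<longrightarrow> y \<in> U) uniformity)"

instance
proof
  fix x y :: cquat and a b :: real
  show "a *\<^sub>R (x + y) = a *\<^sub>R x + a *\<^sub>R y" "(a + b) *\<^sub>R x = a *\<^sub>R x + b *\<^sub>R x"
    "a *\<^sub>R b *\<^sub>R x = (a * b) *\<^sub>R x" "1 *\<^sub>R x = x"
    by (auto simp: scaleR_cquat_def plus_cquat_def algebra_simps)
  show "sgn x = inverse (norm x) *\<^sub>R x" by (rule sgn_cquat_def)
  show "dist x y = norm (x - y)" by (rule dist_cquat_def)
  show "uniformity = (INF e\<in>{0 <..}. principal {(x::cquat, y). dist x y < e})"
    by (rule uniformity_cquat_def)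
  show "open U \<longleftrightarrow> (\<forall>x\<in>U. eventually (\<lambda>(x', y). x' = x \<longrightarrow> y \<in> U) uniformity)"
    for U :: "cquat set" by (rule open_cquat_def)
  show "norm x = 0 \<longleftrightarrow> x = 0"
    by (cases x) (auto simp: norm_cquat_def zero_cquat_def zero_prod_def)
  show "norm (x + y) \<le> norm x + norm y"
    using norm_triangle_ineq[of "(q0 x, q1 x, q2 x, q3 x)" "(q0 y, q1 y, q2 y, q3 y)"]
    by (simp add: norm_cquat_def plus_cquat_def)
  show "norm (a *\<^sub>R x) = \<bar>a\<bar> * norm x"
    using norm_scaleR[of a "(q0 x, q1 x, q2 x, q3 x)"]
    by (simp add: norm_cquat_def scaleR_cquat_def)
qed

end

instance cquat :: real_algebra_1
proof
  fix x y :: cquat and a :: real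
  show "a *\<^sub>R x * y = a *\<^sub>R (x * y)" "x * a *\<^sub>R y = a *\<^sub>R (x * y)"
    by (auto simp: scaleR_cquat_def times_cquat_def scaleR_conv_of_real algebra_simps)
qed

definition cscale :: "complex \<Rightarrow> cquat \<Rightarrow> cquat" (infixr "*\<^sub>C" 75)
  where "c *\<^sub>C x = CQuat (c * q0 x) (c * q1 x) (c * q2 x) (c * q3 x)"

definition qI :: cquat where "qI = CQuat 0 1 0 0"
definition qJ :: cquat where "qJ = CQuat 0 0 1 0"
definition qK :: cquat where "qK = CQuat 0 0 0 1"

lemmas cquat_defs = zero_cquat_def one_cquat_def plus_cquat_def uminus_cquat_def
  minus_cquat_def times_cquat_def scaleR_cquat_def cscale_def qI_def qJ_def qK_def

lemma cquat_unit_products: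
  "qI * qI = -1" "qJ * qJ = -1" "qK * qK = -1"
  "qI * qJ = qK" "qJ * qI = - qK" "qJ * qK = qI" "qK * qJ = - qI" "qK * qI = qJ" "qI * qK = - qJ"
  by (simp_all add: cquat_defs)

lemma cquat_eq_combination: "CQuat a b c d = a *\<^sub>C 1 + b *\<^sub>C qI + c *\<^sub>C qJ + d *\<^sub>C qK"
  by (simp add: cquat_defs)

lemma cscale_of_real: "complex_of_real t *\<^sub>C x = t *\<^sub>R x"
  by (simp add: cquat_defs scaleR_conv_of_real)

subsection \<open>The basis \<open>e\<^sub>1, e\<^sub>2, e\<^sub>3, e\<^sub>4\<close>\<close>

definition e1 :: cquat where "e1 = (1/2) *\<^sub>C (1 + \<i> *\<^sub>C qI)"
definition e2 :: cquat where "e2 = (1/2) *\<^sub>C (1 - \<i> *\<^sub>C qI)"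
definition e3 :: cquat where "e3 = (1/2) *\<^sub>C (\<i> *\<^sub>C qJ - qK)"
definition e4 :: cquat where "e4 = (1/2) *\<^sub>C (\<i> *\<^sub>C qJ + qK)"

definition ebasis :: "nat \<Rightarrow> cquat"
  where "ebasis k = (if k = 1 then e1 else if k = 2 then e2 else if k = 3 then e3 else e4)"

text \<open>\<open>ecoord k x\<close> is the \<open>k\<close>-th coordinate of \<open>x\<close> with respect to this basis
  (\<open>1 = e1 + e2\<close>, \<open>I = -\<i>(e1 - e2)\<close>, \<open>J = -\<i>(e3 + e4)\<close>, \<open>K = e4 - e3\<close>); see
  \<open>ecoord_unique\<close> below.\<close>

definition ecoord :: "nat \<Rightarrow> cquat \<Rightarrow> complex"
  where "ecoord k x =
    (if k = 1 then q0 x - \<i> * q1 x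
     else if k = 2 then q0 x + \<i> * q1 x
     else if k = 3 then - \<i> * q2 x - q3 x
     else - \<i> * q2 x + q3 x)"

lemma ecoord_expand: "(\<Sum>k = 1..4. ecoord k x *\<^sub>C ebasis k) = x"
proof -
  have s: "(\<Sum>k = 1..4. f k) = f 1 + f 2 + f 3 + f (4::nat)" for f :: "nat \<Rightarrow> cquat"
    by (simp add: numeral_eq_Suc)
  show ?thesis
    unfolding s
    by (cases x)
      (simp add: ebasis_def ecoord_def e1_def e2_def e3_def e4_def cquat_defs field_simps)
qed

lemma ecoord_unique:
  assumes "x = c1 *\<^sub>C e1 + c2 *\<^sub>C e2 + c3 *\<^sub>C e3 + c4 *\<^sub>C e4"
  shows "ecoord 1 x = c1" "ecoord 2 x = c2" "ecoord 3 x = c3" "ecoord 4 x = c4"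
  using assms by (simp_all add: ecoord_def e1_def e2_def e3_def e4_def cquat_defs field_simps)

lemma ebasis_products:
  "e1 * e1 = e1" "e1 * e2 = 0" "e1 * e3 = e3" "e1 * e4 = 0"
  "e2 * e1 = 0" "e2 * e2 = e2" "e2 * e3 = 0" "e2 * e4 = e4"
  "e3 * e1 = 0" "e3 * e2 = e3" "e3 * e3 = 0" "e3 * e4 = e1"
  "e4 * e1 = e4" "e4 * e2 = 0" "e4 * e3 = e2" "e4 * e4 = 0"
  by (simp_all add: e1_def e2_def e3_def e4_def cquat_defs field_simps)

definition f1 :: "cquat \<Rightarrow> complex" where "f1 x = ecoord 1 x + ecoord 3 x"
definition f2 :: "cquat \<Rightarrow> complex" where "f2 x = ecoord 2 x + ecoord 4 x"

lemma f1_linear: "f1 (x + y) = f1 x + f1 y" "f1 (c *\<^sub>C x) = c * f1 x"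
  and f2_linear: "f2 (x + y) = f2 x + f2 y" "f2 (c *\<^sub>C x) = c * f2 x"
  by (simp_all add: f1_def f2_def ecoord_def cquat_defs algebra_simps)

lemma f1_basis: "f1 e1 = 1" "f1 e3 = 1" "f1 e2 = 0" "f1 e4 = 0"
  and f2_basis: "f2 e2 = 1" "f2 e4 = 1" "f2 e1 = 0" "f2 e3 = 0"
  by (simp_all add: f1_def f2_def ecoord_def e1_def e2_def e3_def e4_def cquat_defs field_simps)

section \<open>Monogenic mappings\<close>

text \<open>The vector \<open>i\<^sub>1 = 1\<close> is built in; \<open>i2\<close> and \<open>i3\<close> are parameters.\<close>

definition zeta :: "cquat \<Rightarrow> cquat \<Rightarrow> real^3 \<Rightarrow> cquat"
  where "zeta i2 i3 p = (p $ 1) *\<^sub>R 1 + (p $ 2) *\<^sub>R i2 + (p $ 3) *\<^sub>R i3"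

definition E3 :: "cquat \<Rightarrow> cquat \<Rightarrow> cquat set"
  where "E3 i2 i3 = range (zeta i2 i3)"

definition has_right_G_derivative ::
    "cquat \<Rightarrow> cquat \<Rightarrow> (cquat \<Rightarrow> cquat) \<Rightarrow> cquat \<Rightarrow> cquat \<Rightarrow> bool"
  where "has_right_G_derivative i2 i3 \<Phi> D \<zeta> \<longleftrightarrow>
    (\<forall>h\<in>E3 i2 i3.
      ((\<lambda>\<epsilon>::real. inverse \<epsilon> *\<^sub>R (\<Phi> (\<zeta> + \<epsilon> *\<^sub>R h) - \<Phi> \<zeta>)) \<longlongrightarrow> h * D) (at_right 0))"

definition has_left_G_derivative ::
    "cquat \<Rightarrow> cquat \<Rightarrow> (cquat \<Rightarrow> cquat) \<Rightarrow> cquat \<Rightarrow> cquat \<Rightarrow> bool"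
  where "has_left_G_derivative i2 i3 \<Phi> D \<zeta> \<longleftrightarrow>
    (\<forall>h\<in>E3 i2 i3.
      ((\<lambda>\<epsilon>::real. inverse \<epsilon> *\<^sub>R (\<Phi> (\<zeta> + \<epsilon> *\<^sub>R h) - \<Phi> \<zeta>)) \<longlongrightarrow> D * h) (at_right 0))"

definition right_G_monogenic_on ::
    "cquat \<Rightarrow> cquat \<Rightarrow> (cquat \<Rightarrow> cquat) \<Rightarrow> cquat set \<Rightarrow> bool"
  where "right_G_monogenic_on i2 i3 \<Phi> A \<longleftrightarrow>
    continuous_on A \<Phi> \<and> (\<forall>\<zeta>\<in>A. \<exists>D. has_right_G_derivative i2 i3 \<Phi> D \<zeta>)"

definition left_G_monogenic_on ::
    "cquat \<Rightarrow> cquat \<Rightarrow> (cquat \<Rightarrow> cquat) \<Rightarrow> cquat set \<Rightarrow> bool"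
  where "left_G_monogenic_on i2 i3 \<Phi> A \<longleftrightarrow>
    continuous_on A \<Phi> \<and> (\<forall>\<zeta>\<in>A. \<exists>D. has_left_G_derivative i2 i3 \<Phi> D \<zeta>)"

definition right_G_deriv :: "cquat \<Rightarrow> cquat \<Rightarrow> (cquat \<Rightarrow> cquat) \<Rightarrow> cquat \<Rightarrow> cquat"
  where "right_G_deriv i2 i3 \<Phi> \<zeta> = (THE D. has_right_G_derivative i2 i3 \<Phi> D \<zeta>)"

definition left_G_deriv :: "cquat \<Rightarrow> cquat \<Rightarrow> (cquat \<Rightarrow> cquat) \<Rightarrow> cquat \<Rightarrow> cquat"
  where "left_G_deriv i2 i3 \<Phi> \<zeta> = (THE D. has_left_G_derivative i2 i3 \<Phi> D \<zeta>)"

text \<open>The derivatives are unique because \<open>1 \<in> E3\<close>, so \<open>THE\<close> above is harmless.\<close>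

lemma one_in_E3: "1 \<in> E3 i2 i3"
proof -
  have "zeta i2 i3 (axis 1 1) = 1"
    by (simp add: zeta_def axis_def)
  then show ?thesis
    unfolding E3_def by (metis rangeI)
qed

lemma right_G_deriv_eq:
  assumes "has_right_G_derivative i2 i3 \<Phi> D \<zeta>"
  shows "right_G_deriv i2 i3 \<Phi> \<zeta> = D"
proof -
  have "D' = D" if "has_right_G_derivative i2 i3 \<Phi> D' \<zeta>" for D'
    using that assms one_in_E3[of i2 i3] tendsto_unique[OF trivial_limit_at_right_real]
    unfolding has_right_G_derivative_def by (metis mult_1)
  with assms show ?thesis
    unfolding right_G_deriv_def by blast
qed

lemma left_G_deriv_eq:
  assumes "has_left_G_derivative i2 i3 \<Phi> D \<zeta>"
  shows "left_G_deriv i2 i3 \<Phi> \<zeta> = D"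
proof -
  have "D' = D" if "has_left_G_derivative i2 i3 \<Phi> D' \<zeta>" for D'
    using that assms one_in_E3[of i2 i3] tendsto_unique[OF trivial_limit_at_right_real]
    unfolding has_left_G_derivative_def by (metis mult_1_right)
  with assms show ?thesis
    unfolding left_G_deriv_def by blast
qed

text \<open>A mapping that is continuous up to the boundary together with its first-order partial
  derivatives: its values on the frontier are the continuous extension of those in \<open>\<Omega>\<close>, and each
  partial derivative exists in \<open>\<Omega>\<close> and extends continuously to the closure.\<close>

definition C1_up_to_boundary :: "(real^3) set \<Rightarrow> (real^3 \<Rightarrow> cquat) \<Rightarrow> bool"
  where "C1_up_to_boundary \<Omega> F \<longleftrightarrow>
    continuous_on (closure \<Omega>) F \<and>
    (\<forall>m. \<exists>D. continuous_on (closure \<Omega>) D \<and>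
      (\<forall>p\<in>\<Omega>. ((\<lambda>t. F (p + t *\<^sub>R axis m 1)) has_vector_derivative D p) (at 0)))"

section \<open>Piecewise smooth surfaces and integrals\<close>

text \<open>A patch is a parameter domain \<open>G\<close> in the plane together with a parametrization \<open>r\<close>;
  it represents the surface piece \<open>r ` closure G\<close>.\<close>

type_synonym patch = "(real \<times> real) set \<times> (real \<times> real \<Rightarrow> real^3)"

definition patch_normal :: "(real \<times> real \<Rightarrow> real^3) \<Rightarrow> real \<times> real \<Rightarrow> real^3"
  where "patch_normal r u =
    cross3 (frechet_derivative r (at u) (1, 0)) (frechet_derivative r (at u) (0, 1))"

text \<open>The parametrization is continuously differentiable on a neighbourhood of the closed
  parameter domain. Regularity is only required in the open parameter domain, so that e.g.
  spherical coordinates or the tip of a cone are admitted.\<close>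

definition smooth_patch :: "patch \<Rightarrow> bool"
  where "smooth_patch P \<longleftrightarrow> (case P of (G, r) \<Rightarrow>
    open G \<and> connected G \<and> G \<noteq> {} \<and> bounded G \<and> negligible (frontier G) \<and>
    (\<exists>U. open U \<and> closure G \<subseteq> U \<and> r differentiable_on U \<and>
      (\<forall>h. continuous_on U (\<lambda>u. frechet_derivative r (at u) h))) \<and>
    (\<forall>u\<in>G. patch_normal r u \<noteq> 0))"

text \<open>A piecewise smooth surface is given by finitely many patches which overlap at most along
  their edges \<open>r ` frontier G\<close> (edges of a single patch may be glued together).\<close>

definition piecewise_smooth_surface :: "patch list \<Rightarrow> bool"
  where "piecewise_smooth_surface S \<longleftrightarrow>
    (\<forall>P\<in>set S. smooth_patch P) \<and>
    (\<forall>i<length S. \<forall>j<length S. \<forall>u\<in>fst (S ! i). \<forall>v\<in>closure (fst (S ! j)).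
      snd (S ! i) u = snd (S ! j) v \<longrightarrow> i = j \<and> u = v)"

definition surface_points :: "patch list \<Rightarrow> (real^3) set"
  where "surface_points S = (\<Union>(G, r)\<in>set S. r ` closure G)"

text \<open>\<open>S\<close> parametrizes the boundary of \<open>\<Omega>\<close>, oriented by the outward normal: off the edges,
  moving along the normal leaves the closure of \<open>\<Omega>\<close>, moving against it enters \<open>\<Omega>\<close>. The surface is
  closed since it is the whole frontier.\<close>

definition outward_piecewise_smooth_boundary :: "(real^3) set \<Rightarrow> patch list \<Rightarrow> bool"
  where "outward_piecewise_smooth_boundary \<Omega> S \<longleftrightarrow>
    piecewise_smooth_surface S \<and> frontier \<Omega> = surface_points S \<and>
    (\<forall>(G, r)\<in>set S. \<forall>u\<in>G. \<forall>\<^sub>F t in at_right 0.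
      r u + t *\<^sub>R patch_normal r u \<notin> closure \<Omega> \<and> r u - t *\<^sub>R patch_normal r u \<in> \<Omega>)"

text \<open>Integral of \<open>f dy dz\<close>, \<open>f dz dx\<close>, \<open>f dx dy\<close> for \<open>m = 1, 2, 3\<close>: the pullbacks of these
  2-forms are the components of the normal vector times \<open>du dv\<close>.\<close>

definition surface_integral :: "patch list \<Rightarrow> 3 \<Rightarrow> (real^3 \<Rightarrow> complex) \<Rightarrow> complex"
  where "surface_integral S m f =
    (\<Sum>(G, r)\<leftarrow>S. LINT u:G|lborel. f (r u) * complex_of_real (patch_normal r u $ m))"

text \<open>\<open>\<integral> \<sigma> \<Psi>\<close>, \<open>\<integral> \<Psi> \<sigma>\<close> with \<open>\<sigma> = dy dz + dz dx i\<^sub>2 + dx dy i\<^sub>3\<close>, and the volume integral.\<close>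

definition sigma_left_integral ::
    "cquat \<Rightarrow> cquat \<Rightarrow> patch list \<Rightarrow> (cquat \<Rightarrow> cquat) \<Rightarrow> cquat"
  where "sigma_left_integral i2 i3 S \<Psi> = (\<Sum>k = 1..4.
      surface_integral S 1 (\<lambda>p. ecoord k (\<Psi> (zeta i2 i3 p))) *\<^sub>C ebasis k
    + surface_integral S 2 (\<lambda>p. ecoord k (\<Psi> (zeta i2 i3 p))) *\<^sub>C (i2 * ebasis k)
    + surface_integral S 3 (\<lambda>p. ecoord k (\<Psi> (zeta i2 i3 p))) *\<^sub>C (i3 * ebasis k))"

definition sigma_right_integral ::
    "cquat \<Rightarrow> cquat \<Rightarrow> patch list \<Rightarrow> (cquat \<Rightarrow> cquat) \<Rightarrow> cquat"
  where "sigma_right_integral i2 i3 S \<Psi> = (\<Sum>k = 1..4.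
      surface_integral S 1 (\<lambda>p. ecoord k (\<Psi> (zeta i2 i3 p))) *\<^sub>C ebasis k
    + surface_integral S 2 (\<lambda>p. ecoord k (\<Psi> (zeta i2 i3 p))) *\<^sub>C (ebasis k * i2)
    + surface_integral S 3 (\<lambda>p. ecoord k (\<Psi> (zeta i2 i3 p))) *\<^sub>C (ebasis k * i3))"

definition volume_integral ::
    "cquat \<Rightarrow> cquat \<Rightarrow> (real^3) set \<Rightarrow> (cquat \<Rightarrow> cquat) \<Rightarrow> cquat"
  where "volume_integral i2 i3 \<Omega> \<Psi> =
    (\<Sum>k = 1..4. (LINT p:\<Omega>|lborel. ecoord k (\<Psi> (zeta i2 i3 p))) *\<^sub>C ebasis k)"

end

theory Submission
  imports Defs
begin

text \<open>
  The theorem reduces to the divergence theorem one direction \<open>m\<close> at a time: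
  \<open>\<integral>\<^sub>\<Omega> \<partial>\<^sub>m f\<close> is the integral of \<open>f n\<^sub>m\<close> over the boundary. Fubini turns the left-hand side into
  integrals over the lines parallel to the \<open>m\<close>-th axis. By Sard's theorem almost every such line
  avoids the edges and meets the patches only transversally; on such a line the fundamental
  theorem of calculus yields the finite sum of \<open>\<plusminus>f\<close> over the boundary points, the sign being that
  of \<open>n\<^sub>m\<close> since the normal is outward. As \<open>n\<^sub>m du dv\<close> is the Jacobian of the patch projected along
  the axis, the area formula identifies the integral of these sums with the surface integral.
  In particular no partition of unity and no local graph representation is needed.

  For monogenic mappings the partial derivatives are \<open>\<Phi>', i\<^sub>2\<Phi>', i\<^sub>3\<Phi>'\<close> (with the factors on the right
  in the left-monogenic case), and multiplication by \<open>i\<^sub>2\<close> and \<open>i\<^sub>3\<close> is diagonal in the basis \<open>e\<^sub>k\<close>,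
  so the coefficients can be compared coordinate by coordinate.
\<close>

section \<open>The area formula\<close>

text \<open>In finite dimension the operator norm is dominated by the sum of the norms of the images
  of the basis vectors. Continuity of each \<open>f' x h\<close> in \<open>x\<close> thus gives
  continuity of the derivative in operator norm at \<open>a\<close>, as the inverse function
  argument for local injectivity requires.\<close>

lemma continuous_partials_locally_injective:
  fixes f :: "'a::euclidean_space \<Rightarrow> 'a"
  assumes "open S" "a \<in> S"
    and der: "\<And>x. x \<in> S \<Longrightarrow> (f has_derivative f' x) (at x)"
    and cont: "\<And>h. continuous_on S (\<lambda>x. f' x h)"
    and inj: "inj (f' a)"
  obtains r where "r > 0" "ball a r \<subseteq> S" "inj_on f (ball a r)"
proof -
  have lin: "linear (f' x)" if "x \<in> S" for x
    using der[OF that] has_derivative_linear by blast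
  obtain g' where g': "linear g'" "g' \<circ> f' a = id"
    using linear_injective_left_inverse[OF lin[OF \<open>a \<in> S\<close>] inj] by blast
  have small: "\<exists>d>0. \<forall>x. dist a x < d \<longrightarrow> onorm (\<lambda>v. f' x v - f' a v) < e" if "e > 0" for e
  proof -
    define B where "B x = (\<Sum>b\<in>Basis. norm (f' x b - f' a b))" for x
    have "continuous_on S B"
      unfolding B_def by (intro continuous_intros cont)
    then have "isCont B a"
      using assms(1,2) continuous_on_eq_continuous_at by blast
    moreover have "B a = 0" by (simp add: B_def)
    ultimately have "\<forall>\<^sub>F x in nhds a. B x < e"
      using that isContD[of a B] by (metis isCont_def order_tendstoD(2) tendsto_at_iff_tendsto_nhds)
    moreover have "\<forall>\<^sub>F x in nhds a. x \<in> S"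
      using assms(1,2) by (rule eventually_nhds_in_open)
    ultimately have "\<forall>\<^sub>F x in nhds a. B x < e \<and> x \<in> S"
      by (rule eventually_conj)
    then obtain d where d: "d > 0" "\<And>x. dist x a < d \<Longrightarrow> B x < e \<and> x \<in> S"
      unfolding eventually_nhds_metric by blast
    have "onorm (\<lambda>v. f' x v - f' a v) < e" if "dist a x < d" for x
    proof -
      have x: "B x < e" "x \<in> S" using d(2)[of x] that by (auto simp: dist_commute)
      have "bounded_linear (\<lambda>v. f' x v - f' a v)"
        using lin[OF \<open>x \<in> S\<close>] lin[OF \<open>a \<in> S\<close>]
        by (intro bounded_linear_sub) (auto simp: linear_conv_bounded_linear)
      then have "onorm (\<lambda>v. f' x v - f' a v) \<le> B x"
        unfolding B_def by (rule onorm_componentwise)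
      with x show ?thesis by simp
    qed
    with d(1) show ?thesis by blast
  qed
  show thesis
    by (rule has_derivative_locally_injective[OF \<open>a \<in> S\<close> \<open>open S\<close> _ g'(2) der small])
      (use g' in \<open>auto simp: linear_conv_bounded_linear intro: that\<close>)
qed

text \<open>Real integrands are treated as vectors of dimension one, and the gauge integrals of the
  vector-valued change of variables are rewritten as Lebesgue integrals.\<close>

lemma has_absolute_integral_change_of_variables_scalar:
  fixes f :: "real^'n::{finite,wellorder} \<Rightarrow> real" and g :: "real^'n::_ \<Rightarrow> real^'n::_"
  assumes "S \<in> sets lebesgue"
    and "\<And>x. x \<in> S \<Longrightarrow> (g has_derivative g' x) (at x within S)"
    and "inj_on g S"
    and "(\<lambda>x. \<bar>det (matrix (g' x))\<bar> * f (g x)) absolutely_integrable_on S"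
  shows "f absolutely_integrable_on (g ` S)"
    and "(LINT y:g ` S|lebesgue. f y) = (LINT x:S|lebesgue. \<bar>det (matrix (g' x))\<bar> * f (g x))"
proof -
  let ?f = "\<lambda>y. vec (f y) :: real^1"
  let ?D = "\<lambda>x. \<bar>det (matrix (g' x))\<bar> *\<^sub>R ?f (g x)"
  have D: "?D = (\<lambda>x. vec (\<bar>det (matrix (g' x))\<bar> * f (g x)))"
    by (auto simp: vec_eq_iff)
  have 1: "?D absolutely_integrable_on S"
    unfolding D using assms(4) by (simp add: absolutely_integrable_on_1_iff)
  have 2: "?f absolutely_integrable_on (g ` S) \<and> integral (g ` S) ?f = integral S ?D"
    using has_absolute_integral_change_of_variables[OF assms(1-3), of ?f "integral S ?D"] 1 by blast
  then show f: "f absolutely_integrable_on (g ` S)"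
    by (simp add: absolutely_integrable_on_1_iff)
  have "integral (g ` S) f = integral S (\<lambda>x. \<bar>det (matrix (g' x))\<bar> * f (g x))"
    using 2 unfolding D by (simp add: integral_on_1_eq o_def vec_eq_iff)
  then show "(LINT y:g ` S|lebesgue. f y) = (LINT x:S|lebesgue. \<bar>det (matrix (g' x))\<bar> * f (g x))"
    using set_lebesgue_integral_eq_integral(2)[OF f] set_lebesgue_integral_eq_integral(2)[OF assms(4)]
    by simp
qed

lemma continuous_on_det_matrix:
  fixes f' :: "'a::topological_space \<Rightarrow> real^'n \<Rightarrow> real^'n"
  assumes "\<And>h. continuous_on S (\<lambda>x. f' x h)"
  shows "continuous_on S (\<lambda>x. det (matrix (f' x)))"
  unfolding det_def matrix_def by (simp, intro continuous_intros assms)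

text \<open>The fibre sum is finite only almost everywhere, and a sum over an infinite set is \<open>0\<close> by
  convention; hence it is represented by an integrable \<open>H\<close>, obtained as a series over countably
  many pieces on which \<open>f\<close> is injective.\<close>

lemma area_formula:
  fixes f :: "real^'n::{finite,wellorder} \<Rightarrow> real^'n::_" and g :: "real^'n::_ \<Rightarrow> real"
  assumes "open G"
    and der: "\<And>x. x \<in> G \<Longrightarrow> (f has_derivative f' x) (at x)"
    and cont: "\<And>h. continuous_on G (\<lambda>x. f' x h)"
    and int: "(\<lambda>x. g x * det (matrix (f' x))) absolutely_integrable_on G"
    and fin: "AE y in lebesgue. finite {x\<in>G. f x = y \<and> det (matrix (f' x)) \<noteq> 0}"
  obtains H where "integrable lebesgue H"
    and "integral\<^sup>L lebesgue H = (LINT x:G|lebesgue. g x * det (matrix (f' x)))"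
    and "AE y in lebesgue.
      H y = (\<Sum>x | x \<in> G \<and> f x = y \<and> det (matrix (f' x)) \<noteq> 0. g x * sgn (det (matrix (f' x))))"
proof -
  define J where "J x = det (matrix (f' x))" for x
  define R where "R = {x\<in>G. J x \<noteq> 0}"
  define N where "N y = {x\<in>G. f x = y \<and> J x \<noteq> 0}" for y
  have NR: "N y = {x\<in>R. f x = y}" for y
    by (auto simp: N_def R_def)
  have Jcont: "continuous_on G J"
    unfolding J_def by (rule continuous_on_det_matrix[OF cont])
  have "R = G \<inter> J -` (- {0})"
    by (auto simp: R_def)
  then have R: "open R" "R \<subseteq> G"
    using continuous_open_preimage[OF Jcont \<open>open G\<close>, of "- {0}"] by (auto simp: open_Compl)
  have "\<exists>V. open V \<and> x \<in> V \<and> V \<subseteq> R \<and> inj_on f V" if x: "x \<in> R" for x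
  proof -
    have "inj (f' x)"
      using that der[of x] unfolding R_def J_def
      by (auto simp: det_nz_iff_inj has_derivative_linear)
    then obtain r where "r > 0" "ball x r \<subseteq> R" "inj_on f (ball x r)"
      using continuous_partials_locally_injective[OF R(1) x, of f f',
          OF der continuous_on_subset[OF cont R(2)]] R(2)
      by blast
    then show ?thesis
      by (intro exI[of _ "ball x r"]) auto
  qed
  then obtain V where V: "open (V x)" "x \<in> V x" "V x \<subseteq> R" "inj_on f (V x)" if "x \<in> R" for x
    by metis
  \<comment> \<open>A countable cover of \<open>R\<close> by sets of injectivity turns the fibre sum
    into a series of one-point contributions.\<close>
  obtain \<V> where \<V>: "\<V> \<subseteq> V ` R" "countable \<V>" "\<Union>\<V> = \<Union>(V ` R)"
    using Lindelof[of "V ` R"] V(1) by (metis imageE)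
  \<comment> \<open>The set \<open>{}\<close> is added so that the enumeration ranges over a
    nonempty family even if \<open>R\<close>, and with it the cover, is empty.\<close>
  define W where "W = from_nat_into (insert {} \<V>)"
  have rangeW: "range W = insert {} \<V>"
    unfolding W_def using \<V>(2) by (intro range_from_nat_into) auto
  have W: "open (W n)" "inj_on f (W n)" for n
  proof -
    have "W n \<in> insert {} (V ` R)"
      using rangeW \<V>(1) by auto
    then show "open (W n)" "inj_on f (W n)"
      using V by auto
  qed
  have UW: "(\<Union>n. W n) = R"
  proof -
    have "(\<Union>n. W n) = \<Union>(V ` R)"
      using rangeW \<V>(3) by simp
    also have "\<dots> = R"
      using V(2,3) by blast
    finally show ?thesis .
  qed
  define A where "A = disjointed W"
  have A: "A n \<in> sets borel" "inj_on f (A n)" "A n \<subseteq> R" for n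
  proof -
    have "range (disjointed W) \<subseteq> sets borel"
      by (intro sets.range_disjointed_sets) (use W(1) in auto)
    then show "A n \<in> sets borel"
      by (auto simp: A_def)
    show "inj_on f (A n)" "A n \<subseteq> R"
      using disjointed_subset[of W n] W(2) UW by (auto simp: A_def intro: inj_on_subset)
  qed
  have UA: "(\<Union>n. A n) = R" and disj: "disjoint_family A"
    by (simp_all add: A_def UN_disjointed_eq UW disjoint_family_disjointed)
  have Aleb: "A n \<in> sets lebesgue" for n
    using A(1)[of n] by (simp add: sets_completionI_sets)
  have Rleb: "R \<in> sets lebesgue"
    using R(1) by (simp add: borel_open sets_completionI_sets)
  \<comment> \<open>\<open>h n\<close> transports the weight to the image of \<open>A n\<close>. The
    change of variables contributes \<open>\<bar>J x\<bar>\<close>, and the factor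
    \<open>sgn (J x)\<close> restores the signed Jacobian.\<close>
  define h where "h n y = (let x = inv_into (A n) f y in g x * sgn (J x))" for n y
  have hf: "h n (f x) = g x * sgn (J x)" if "x \<in> A n" for n x
    using A(2) that by (simp add: h_def)
  have intR: "set_integrable lebesgue R (\<lambda>x. g x * J x)"
    using set_integrable_subset[OF int Rleb R(2)] by (simp add: J_def)
  have intA: "set_integrable lebesgue (A n) (\<lambda>x. g x * J x)" for n
    using set_integrable_subset[OF intR Aleb A(3)] .
  have hint: "set_integrable lebesgue (f ` A n) (h n)"
    "(LINT y:f ` A n|lebesgue. h n y) = (LINT x:A n|lebesgue. g x * J x)"
    "(LINT y:f ` A n|lebesgue. \<bar>h n y\<bar>) = (LINT x:A n|lebesgue. \<bar>g x * J x\<bar>)" for n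
  proof -
    have der': "(f has_derivative f' x) (at x within A n)" if "x \<in> A n" for x
      using der that A(3) R(2) by (blast intro: has_derivative_at_withinI)
    have eq: "\<bar>J x\<bar> * h n (f x) = g x * J x" if "x \<in> A n" for x
      using hf[OF that] by (simp add: abs_sgn mult_ac) argo
    have eq': "\<bar>J x\<bar> * \<bar>h n (f x)\<bar> = \<bar>g x * J x\<bar>" if "x \<in> A n" for x
      using eq[OF that] by (metis abs_abs abs_mult)
    have 1: "set_integrable lebesgue (A n) (\<lambda>x. \<bar>J x\<bar> * h n (f x))"
      using intA[of n] by (subst set_integrable_cong[OF refl refl eq]) auto
    have 2: "set_integrable lebesgue (A n) (\<lambda>x. \<bar>J x\<bar> * \<bar>h n (f x)\<bar>)"
      using set_integrable_abs[OF intA[of n]] by (subst set_integrable_cong[OF refl refl eq']) auto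
    note cv = has_absolute_integral_change_of_variables_scalar[OF Aleb der' A(2), folded J_def]
    show "set_integrable lebesgue (f ` A n) (h n)"
      by (rule cv(1)) (use 1 in auto)
    show "(LINT y:f ` A n|lebesgue. h n y) = (LINT x:A n|lebesgue. g x * J x)"
      by (rule trans[OF cv(2) set_lebesgue_integral_cong]) (use 1 eq Aleb in auto)
    show "(LINT y:f ` A n|lebesgue. \<bar>h n y\<bar>) = (LINT x:A n|lebesgue. \<bar>g x * J x\<bar>)"
      by (rule trans[OF cv(2) set_lebesgue_integral_cong]) (use 2 eq' Aleb in auto)
  qed
  define k where "k n y = indicator (f ` A n) y * h n y" for n y
  have k: "integrable lebesgue (k n)" for n
    using hint(1)[of n] by (simp add: set_integrable_def k_def[abs_def])
  have kint: "integral\<^sup>L lebesgue (k n) = (LINT x:A n|lebesgue. g x * J x)" for n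
    using hint(2)[of n] by (simp add: set_lebesgue_integral_def k_def[abs_def])
  have knorm: "(LINT y|lebesgue. norm (k n y)) = (LINT x:A n|lebesgue. \<bar>g x * J x\<bar>)" for n
    using hint(3)[of n] by (simp add: set_lebesgue_integral_def k_def[abs_def] abs_mult)
  \<comment> \<open>The pieces are disjoint, so the partial sums are bounded by the integral of
    \<open>\<bar>g x * J x\<bar>\<close> over \<open>R\<close>. This justifies exchanging series and
    integral.\<close>
  have sumk: "summable (\<lambda>n. LINT y|lebesgue. norm (k n y))"
  proof (rule summableI_nonneg_bounded)
    fix n
    have int_abs: "set_integrable lebesgue (A i) (\<lambda>x. \<bar>g x * J x\<bar>)" for i
      using set_integrable_abs[OF intA] .
    have "(\<Sum>i<n. LINT y|lebesgue. norm (k i y)) = (LINT x|lebesgue. (\<Sum>i<n. indicator (A i) x * \<bar>g x * J x\<bar>))"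
      using int_abs unfolding knorm set_lebesgue_integral_def set_integrable_def
      by (subst Bochner_Integration.integral_sum) simp_all
    also have "\<dots> \<le> (LINT x|lebesgue. indicator R x * \<bar>g x * J x\<bar>)"
    proof (rule integral_mono)
      show "integrable lebesgue (\<lambda>x. \<Sum>i<n. indicator (A i) x * \<bar>g x * J x\<bar>)"
        using int_abs unfolding set_integrable_def
        by (intro Bochner_Integration.integrable_sum) simp
      show "integrable lebesgue (\<lambda>x. indicator R x * \<bar>g x * J x\<bar>)"
        using set_integrable_abs[OF intR] unfolding set_integrable_def by simp
      fix x
      have "(\<Sum>i<n. indicator (A i) x) = (indicator (\<Union>i<n. A i) x :: real)"
        using disj by (intro indicator_UN_disjoint[symmetric])
          (auto simp: disjoint_family_on_def)
      also have "\<dots> \<le> indicator R x"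
        using UA by (auto simp: indicator_def)
      finally show "(\<Sum>i<n. indicator (A i) x * \<bar>g x * J x\<bar>) \<le> indicator R x * \<bar>g x * J x\<bar>"
        by (simp add: sum_distrib_right[symmetric] mult_right_mono)
    qed
    finally show "(\<Sum>i<n. LINT y|lebesgue. norm (k i y)) \<le> (LINT x|lebesgue. indicator R x * \<bar>g x * J x\<bar>)" .
  qed simp
  have key: "(\<lambda>n. k n y) sums (\<Sum>x\<in>N y. g x * sgn (J x))" "summable (\<lambda>n. norm (k n y))"
    if fin: "finite (N y)" for y
  proof -
    \<comment> \<open>Injectivity on \<open>A n\<close> leaves at most one point of the fibre in
      that piece.\<close>
    have k_eq: "k n y = (\<Sum>x\<in>N y \<inter> A n. g x * sgn (J x))" for n
    proof (cases "y \<in> f ` A n")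
      case True
      then obtain x where x: "x \<in> A n" "y = f x" by blast
      have "N y \<inter> A n = {x}"
        using x A(2,3) by (auto simp: NR dest: inj_onD)
      then show ?thesis
        using x hf[OF x(1)] by (simp add: k_def)
    next
      case False
      then have "N y \<inter> A n = {}"
        by (auto simp: NR)
      with False show ?thesis
        by (simp add: k_def)
    qed
    have "\<exists>n. x \<in> A n" if "x \<in> N y" for x
      using that UA by (auto simp: NR)
    then obtain ix where ix: "x \<in> A (ix x)" if "x \<in> N y" for x
      by metis
    have ix_unique: "ix x = n" if "x \<in> N y" "x \<in> A n" for x n
      using that ix disj by (fastforce simp: disjoint_family_on_def)
    \<comment> \<open>Each point of the fibre lies in exactly one piece, so for a finite fibre only
      the indices in \<open>K\<close> contribute and the series is a finite sum.\<close>
    define K where "K = ix ` N y"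
    have K: "finite K" using fin by (simp add: K_def)
    have k0: "k n y = 0" if "n \<notin> K" for n
    proof -
      have "N y \<inter> A n = {}"
        using that ix_unique by (auto simp: K_def)
      then show ?thesis by (simp add: k_eq)
    qed
    have "(\<Sum>n\<in>K. k n y) = (\<Sum>n\<in>K. \<Sum>x | x \<in> N y \<and> ix x = n. g x * sgn (J x))"
      unfolding k_eq using ix ix_unique by (intro sum.cong refl) auto
    also have "\<dots> = (\<Sum>x\<in>N y. g x * sgn (J x))"
      using fin K by (intro sum.group) (auto simp: K_def)
    finally show "(\<lambda>n. k n y) sums (\<Sum>x\<in>N y. g x * sgn (J x))"
      using sums_finite[OF K, of "\<lambda>n. k n y"] k0 by simp
    show "summable (\<lambda>n. norm (k n y))"
      by (rule summable_finite[OF K]) (simp add: k0)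
  qed
  have fin': "AE y in lebesgue. finite (N y)"
    using fin by (simp add: N_def J_def)
  have AEsum: "AE y in lebesgue. summable (\<lambda>n. norm (k n y))"
    using fin' by (rule eventually_mono) (rule key)
  show thesis
  proof
    show "integrable lebesgue (\<lambda>y. \<Sum>n. k n y)"
      by (rule integrable_suminf[OF k AEsum sumk])
    have "(LINT y|lebesgue. (\<Sum>n. k n y)) = (\<Sum>n. LINT x:A n|lebesgue. g x * J x)"
      using integral_suminf[OF k AEsum sumk] by (simp add: kint)
    also have "\<dots> = (LINT x:R|lebesgue. g x * J x)"
      using lebesgue_integral_countable_add[of A lebesgue "\<lambda>x. g x * J x"] Aleb disj intR UA
      by (auto simp: disjoint_family_on_def)
    \<comment> \<open>The integrand vanishes on \<open>G - R\<close>, where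
      \<open>J x = 0\<close>.\<close>
    also have "\<dots> = (LINT x:G|lebesgue. g x * J x)"
      unfolding set_lebesgue_integral_def
      by (intro Bochner_Integration.integral_cong) (auto simp: R_def indicator_def)
    finally show "(LINT y|lebesgue. (\<Sum>n. k n y)) = (LINT x:G|lebesgue. g x * det (matrix (f' x)))"
      by (simp add: J_def)
    have "AE y in lebesgue. (\<Sum>n. k n y) = (\<Sum>x\<in>N y. g x * sgn (J x))"
      using fin' by (rule eventually_mono) (rule sums_unique[OF key(1), symmetric])
    then show "AE y in lebesgue. (\<Sum>n. k n y) =
        (\<Sum>x | x \<in> G \<and> f x = y \<and> det (matrix (f' x)) \<noteq> 0. g x * sgn (det (matrix (f' x))))"
      by (simp add: N_def J_def)
  qed
qed

section \<open>The fundamental theorem of calculus on an open subset of the line\<close>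

lemma set_integral_Ioo_FTC:
  fixes F f :: "real \<Rightarrow> real"
  assumes "a < b" "continuous_on {a..b} F" "continuous_on {a..b} f"
    and "\<And>t. a < t \<Longrightarrow> t < b \<Longrightarrow> (F has_vector_derivative f t) (at t)"
  shows "set_integrable lborel {a<..<b} f" "(LINT t:{a<..<b}|lborel. f t) = F b - F a"
proof -
  have "set_integrable lborel {a..b} f"
    using assms(3) by (rule borel_integrable_atLeastAtMost')
  then show i: "set_integrable lborel {a<..<b} f"
    by (rule set_integrable_subset) auto
  have "(f has_integral F b - F a) {a..b}"
    using assms by (intro fundamental_theorem_of_calculus_interior) auto
  then show "(LINT t:{a<..<b}|lborel. f t) = F b - F a"
    using set_borel_integral_eq_integral(2)[OF i] integral_open_interval_real[of a b f]
    by (simp add: integral_unique)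
qed

text \<open>\<open>C\<close> is to be the trace of the closed region on a line, \<open>W\<close>
  that of the open one. By \<open>sides\<close> every point of \<open>C - W\<close> is isolated, so
  this compact set is finite. Then \<open>W\<close> is a finite union of intervals whose right ends
  have \<open>\<sigma> = 1\<close> and whose left ends have \<open>\<sigma> = -1\<close>, and each
  contributes \<open>F b - F a\<close>.\<close>

lemma integral_derivative_open_set:
  fixes F f \<sigma> :: "real \<Rightarrow> real" and W C :: "real set"
  assumes "open W" "compact C" "W \<subseteq> C"
    and contF: "continuous_on C F" and contf: "continuous_on C f"
    and der: "\<And>t. t \<in> W \<Longrightarrow> (F has_vector_derivative f t) (at t)"
    and \<sigma>: "\<And>t. t \<in> C - W \<Longrightarrow> \<sigma> t = 1 \<or> \<sigma> t = -1"
    and sides: "\<And>t. t \<in> C - W \<Longrightarrow> \<forall>\<^sub>F \<delta> in at_right 0. t + \<sigma> t * \<delta> \<notin> C \<and> t - \<sigma> t * \<delta> \<in> W"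
  shows "finite (C - W)" and "(LINT t:W|lborel. f t) = (\<Sum>t\<in>C - W. \<sigma> t * F t)"
proof -
  have "closed C" "bounded C" "bounded W"
    using \<open>compact C\<close> \<open>W \<subseteq> C\<close> by (auto intro: compact_imp_closed compact_imp_bounded bounded_subset)
  have isolated: "\<not> t islimpt (C - W)" if t: "t \<in> C - W" for t
  proof -
    obtain e where e: "e > 0" "\<And>\<delta>. 0 < \<delta> \<Longrightarrow> \<delta> < e \<Longrightarrow> t + \<sigma> t * \<delta> \<notin> C \<and> t - \<sigma> t * \<delta> \<in> W"
      using sides[OF t] by (auto simp: eventually_at_right_field)
    have "x \<notin> C - W" if "x \<noteq> t" "dist x t < e" for x
      using e(2)[of "\<bar>x - t\<bar>"] that \<sigma>[OF t] by (auto simp: dist_real_def abs_if split: if_splits)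
    with e(1) show ?thesis
      unfolding islimpt_approachable by blast
  qed
  have "compact (C - W)"
    using \<open>compact C\<close> \<open>open W\<close> by (rule compact_diff)
  with isolated show fin: "finite (C - W)"
    using Heine_Borel_imp_Bolzano_Weierstrass by blast
  define T where "T c = {t\<in>C - W. c < t}" for c
  have finT: "finite (T c)" for c
    unfolding T_def using fin by (rule finite_subset[rotated]) blast
  \<comment> \<open>A connected set that avoids \<open>C - W\<close> is covered by the disjoint open
    sets \<open>W\<close> and \<open>- C\<close>, so it lies in one of them.\<close>
  have dichotomy: "X \<subseteq> W \<or> X \<inter> C = {}" if "connected X" "X \<inter> (C - W) = {}" for X
    using connectedD[OF that(1) \<open>open W\<close>, of "- C"] \<open>closed C\<close> \<open>W \<subseteq> C\<close> that(2) by blast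
  obtain M where M: "\<And>t. t \<in> W \<Longrightarrow> \<bar>t\<bar> \<le> M"
    using \<open>bounded W\<close> unfolding bounded_iff by auto
  have ray: "\<exists>t>x. t \<notin> W" for x
    using M[of "max (x + 1) (M + 1)"] by (intro exI[of _ "max (x + 1) (M + 1)"]) auto
  have small: "\<exists>\<delta>. 0 < \<delta> \<and> \<delta> < e \<and> t + \<sigma> t * \<delta> \<notin> C \<and> t - \<sigma> t * \<delta> \<in> W"
    if "t \<in> C - W" "e > 0" for t e
    using eventually_happens[OF eventually_conj[OF sides[OF that(1)] eventually_at_right_real[OF that(2)]]]
    by auto
  \<comment> \<open>The intervals are split off from the left, by induction on the number of
    boundary points beyond a point \<open>c\<close> outside \<open>C\<close>.\<close>
  have main: "set_integrable lborel (W \<inter> {c<..}) f \<and>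
      (LINT t:W \<inter> {c<..}|lborel. f t) = (\<Sum>t\<in>T c. \<sigma> t * F t)" if "c \<notin> C" for c
    using that
  proof (induction "card (T c)" arbitrary: c rule: less_induct)
    case less
    show ?case
    proof (cases "T c = {}")
      case True
      have "{c..} \<inter> (C - W) = {}"
        using True less.prems by (force simp: T_def order_le_less)
      then have "{c..} \<subseteq> W \<or> {c..} \<inter> C = {}"
        by (intro dichotomy) auto
      moreover have "c \<in> {c..}" by simp
      ultimately have "{c..} \<inter> C = {}"
        using less.prems \<open>W \<subseteq> C\<close> by blast
      moreover have "{c<..} \<subseteq> {c..}" by auto
      ultimately have "W \<inter> {c<..} = {}"
        using \<open>W \<subseteq> C\<close> by blast
      then show ?thesis
        by (simp add: True set_integrable_def set_lebesgue_integral_def)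
    next
      case False
      define a where "a = Min (T c)"
      have aT: "a \<in> T c" and amin: "\<And>t. t \<in> T c \<Longrightarrow> a \<le> t"
        using finT False by (auto simp: a_def)
      have a: "a \<in> C" "a \<notin> W" "c < a"
        using aT by (auto simp: T_def)
      have "{c..<a} \<inter> (C - W) = {}"
        using amin less.prems by (force simp: T_def order_le_less)
      then have "{c..<a} \<subseteq> W \<or> {c..<a} \<inter> C = {}"
        by (intro dichotomy) auto
      moreover have "c \<in> {c..<a}" using a by simp
      ultimately have ca: "{c..<a} \<inter> C = {}"
        using less.prems \<open>W \<subseteq> C\<close> by blast
      \<comment> \<open>Points between \<open>c\<close> and \<open>a\<close> are outside
        \<open>C\<close>, so \<open>a\<close> can only be a left end.\<close>
      have sa: "\<sigma> a = -1"
      proof (rule ccontr)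
        assume "\<sigma> a \<noteq> -1"
        then have "\<sigma> a = 1" using \<sigma> a by blast
        then obtain \<delta> where "0 < \<delta>" "\<delta> < a - c" "a - \<delta> \<in> W"
          using small[of a "a - c"] a by auto
        then have "a - \<delta> \<in> {c..<a} \<inter> C"
          using \<open>W \<subseteq> C\<close> by auto
        with ca show False by blast
      qed
      \<comment> \<open>Otherwise the component of \<open>W\<close> starting at \<open>a\<close>
        would be a whole ray, contradicting boundedness.\<close>
      have "T a \<noteq> {}"
      proof
        assume "T a = {}"
        then have "{a<..} \<subseteq> W \<or> {a<..} \<inter> C = {}"
          by (intro dichotomy) (auto simp: T_def)
        moreover obtain \<delta> where "0 < \<delta>" "a + \<delta> \<in> W"
          using small[of a 1] a sa by auto
        moreover from this have "a + \<delta> \<in> {a<..} \<inter> C"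
          using \<open>W \<subseteq> C\<close> by auto
        ultimately have "{a<..} \<subseteq> W"
          by blast
        with ray[of a] show False by auto
      qed
      define b where "b = Min (T a)"
      have bT: "b \<in> T a" and bmin: "\<And>t. t \<in> T a \<Longrightarrow> b \<le> t"
        using finT \<open>T a \<noteq> {}\<close> by (auto simp: b_def)
      have b: "b \<in> C" "b \<notin> W" "a < b"
        using bT by (auto simp: T_def)
      have "{a<..<b} \<inter> (C - W) = {}"
        using bmin by (force simp: T_def)
      then have "{a<..<b} \<subseteq> W \<or> {a<..<b} \<inter> C = {}"
        by (intro dichotomy) auto
      moreover obtain \<delta> where "0 < \<delta>" "\<delta> < b - a" "a + \<delta> \<in> W"
        using small[of a "b - a"] a b sa by auto
      then have "a + \<delta> \<in> {a<..<b} \<inter> C"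
        using \<open>W \<subseteq> C\<close> by auto
      ultimately have ab: "{a<..<b} \<subseteq> W"
        by blast
      \<comment> \<open>Points between \<open>a\<close> and \<open>b\<close> are in
        \<open>W\<close>, so \<open>b\<close> can only be a right end.\<close>
      have sb: "\<sigma> b = 1"
      proof (rule ccontr)
        assume "\<sigma> b \<noteq> 1"
        then have "\<sigma> b = -1" using \<sigma> b by blast
        then obtain \<delta> where "0 < \<delta>" "\<delta> < b - a" "b - \<delta> \<notin> C"
          using small[of b "b - a"] b by auto
        moreover from this have "b - \<delta> \<in> {a<..<b}" by auto
        ultimately show False
          using ab \<open>W \<subseteq> C\<close> by blast
      qed
      obtain e where e: "e > 0" "\<And>\<delta>. 0 < \<delta> \<Longrightarrow> \<delta> < e \<Longrightarrow> b + \<delta> \<notin> C"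
        using sides[of b] b sb by (auto simp: eventually_at_right_field)
      \<comment> \<open>Beyond a right end there is a gap in \<open>C\<close>. The point
        \<open>c'\<close> in it is the new starting point; the boundary points ahead have lost
        exactly \<open>a\<close> and \<open>b\<close>.\<close>
      define c' where "c' = b + e / 2"
      have gap: "t \<notin> C" if "b < t" "t \<le> c'" for t
        using e(2)[of "t - b"] that e(1) by (auto simp: c'_def)
      have c': "b < c'" "c' \<notin> C"
        using e(1) gap[of c'] by (auto simp: c'_def)
      have Tc: "T c = insert a (insert b (T c'))"
      proof (intro equalityI subsetI)
        fix t assume t: "t \<in> T c"
        show "t \<in> insert a (insert b (T c'))"
          using amin[OF t] bmin[of t] t gap[of t] by (fastforce simp: T_def)
      qed (use a b c' in \<open>auto simp: T_def\<close>)
      have notin: "a \<notin> insert b (T c')" "b \<notin> T c'"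
        using b c' by (auto simp: T_def)
      have IH: "set_integrable lborel (W \<inter> {c'<..}) f"
        "(LINT t:W \<inter> {c'<..}|lborel. f t) = (\<Sum>t\<in>T c'. \<sigma> t * F t)"
        using less.hyps[of c'] c' notin finT by (auto simp: Tc)
      have W: "W \<inter> {c<..} = {a<..<b} \<union> (W \<inter> {c'<..})"
      proof (intro equalityI subsetI)
        fix t assume t: "t \<in> W \<inter> {c<..}"
        then have "t \<in> C" using \<open>W \<subseteq> C\<close> by blast
        moreover have "t \<in> {c..<a}" if "t < a" using that t by auto
        ultimately have "\<not> t < a" using ca by blast
        moreover have "\<not> (b < t \<and> t \<le> c')" using gap[of t] \<open>t \<in> C\<close> by blast
        moreover have "t \<noteq> a" "t \<noteq> b" using a b t by auto
        ultimately show "t \<in> {a<..<b} \<union> (W \<inter> {c'<..})"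
          using t by auto
      qed (use a b c' ab in auto)
      have "{a..b} \<subseteq> C"
        using ab \<open>W \<subseteq> C\<close> a b by (force simp: order_le_less)
      then have ftc: "set_integrable lborel {a<..<b} f" "(LINT t:{a<..<b}|lborel. f t) = F b - F a"
        using set_integral_Ioo_FTC[OF \<open>a < b\<close>, of F f] contF contf der ab
        by (auto simp: continuous_on_subset subset_iff)
      have "W \<in> sets lborel" using \<open>open W\<close> by simp
      then have "set_integrable lborel (W \<inter> {c<..}) f"
        unfolding W by (intro set_integrable_Un ftc IH) auto
      moreover have "(LINT t:W \<inter> {c<..}|lborel. f t) = (\<Sum>t\<in>T c. \<sigma> t * F t)"
        unfolding W using c'(1) b(3) notin finT
        by (subst set_integral_Un[OF _ ftc(1) IH(1)]) (auto simp: ftc IH Tc sa sb)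
      ultimately show ?thesis by blast
    qed
  qed
  \<comment> \<open>The induction is started from a point to the left of all of
    \<open>C\<close>.\<close>
  obtain K where K: "K \<notin> C" "\<And>t. t \<in> W \<Longrightarrow> K < t" "\<And>t. t \<in> C - W \<Longrightarrow> K < t"
  proof -
    obtain B where "\<And>t. t \<in> C \<Longrightarrow> \<bar>t\<bar> \<le> B"
      using \<open>bounded C\<close> unfolding bounded_iff by auto
    then have "\<And>t. t \<in> C \<Longrightarrow> - B - 1 < t" "- B - 1 \<notin> C"
      by (force, force)
    then show thesis
      using that[of "- B - 1"] \<open>W \<subseteq> C\<close> by blast
  qed
  have "W \<inter> {K<..} = W" "T K = C - W"
    using K by (auto simp: T_def)
  with main[OF K(1)] show "(LINT t:W|lborel. f t) = (\<Sum>t\<in>C - W. \<sigma> t * F t)" by simp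
qed

section \<open>The sides of a surface along a transversal\<close>

text \<open>A sufficiently small double cone around the normal, containing \<open>v\<close>, misses the frontier of
  \<open>\<Omega>\<close>. Each half is convex, hence lies on one side.\<close>

lemma sides_along_transversal:
  fixes r :: "'a::euclidean_space \<Rightarrow> 'b::euclidean_space"
  assumes der: "(r has_derivative r') (at u)" and "inj r'"
    and normal: "\<And>h. r' h \<bullet> n = 0" and "n \<noteq> 0"
    and loc: "\<And>d. d > 0 \<Longrightarrow> \<exists>e>0. \<forall>q\<in>frontier \<Omega>. dist q (r u) < e \<longrightarrow> q \<in> r ` ball u d"
    and out: "\<forall>\<^sub>F t in at_right 0. r u + t *\<^sub>R n \<notin> closure \<Omega> \<and> r u - t *\<^sub>R n \<in> \<Omega>"
    and "v \<bullet> n > 0"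
  shows "\<forall>\<^sub>F t in at_right 0. r u + t *\<^sub>R v \<notin> closure \<Omega> \<and> r u - t *\<^sub>R v \<in> \<Omega>"
proof -
  have "v \<noteq> 0" using \<open>v \<bullet> n > 0\<close> by auto
  \<comment> \<open>This is the largest \<open>c\<close> for which both \<open>v\<close> and
    \<open>n\<close> lie in the cone \<open>c * norm w \<le> w \<bullet> n\<close>.\<close>
  define c where "c = min (v \<bullet> n / norm v) (norm n)"
  have "c > 0" using \<open>v \<bullet> n > 0\<close> \<open>v \<noteq> 0\<close> \<open>n \<noteq> 0\<close> by (simp add: c_def)
  have lin: "linear r'" using der by (rule has_derivative_linear)
  obtain \<kappa> where "\<kappa> > 0" and \<kappa>: "\<And>h. \<kappa> * norm h \<le> norm (r' h)"
    using linear_inj_bounded_below_pos[OF lin \<open>inj r'\<close>] by blast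
  \<comment> \<open>The bound \<open>\<kappa> / 2\<close> lets \<open>norm w\<close> control
    \<open>norm h\<close> below; the other bound keeps the normal part of the remainder at most half
    of what the cone demands.\<close>
  define \<epsilon> where "\<epsilon> = min (\<kappa> / 2) (c * \<kappa> / (4 * norm n))"
  have \<epsilon>: "\<epsilon> > 0" "\<epsilon> \<le> \<kappa> / 2" "\<epsilon> * norm n \<le> c * \<kappa> / 4"
  proof -
    show "\<epsilon> > 0" using \<open>\<kappa> > 0\<close> \<open>c > 0\<close> \<open>n \<noteq> 0\<close> by (simp add: \<epsilon>_def)
    have "\<epsilon> \<le> c * \<kappa> / (4 * norm n)" by (simp add: \<epsilon>_def)
    then show "\<epsilon> * norm n \<le> c * \<kappa> / 4" using \<open>n \<noteq> 0\<close> by (simp add: field_simps)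
  qed (simp add: \<epsilon>_def)
  obtain d where "d > 0" and d: "\<And>x. norm (x - u) < d \<Longrightarrow> norm (r x - r u - r' (x - u)) \<le> \<epsilon> * norm (x - u)"
    using der \<epsilon>(1) unfolding has_derivative_at_alt by blast
  obtain e where "e > 0" and e: "\<And>q. q \<in> frontier \<Omega> \<Longrightarrow> dist q (r u) < e \<Longrightarrow> q \<in> r ` ball u d"
    using loc[OF \<open>d > 0\<close>] by blast
  \<comment> \<open>A frontier point near \<open>r u\<close> has the form \<open>r x\<close>, so
    \<open>w\<close> is a tangent vector plus a remainder \<open>R\<close>, and only
    \<open>R\<close> has a component along \<open>n\<close>. That component is too small for the
    cone.\<close>
  have miss: "r u + w \<notin> frontier \<Omega>" if w: "w \<noteq> 0" "norm w < e" "c * norm w \<le> \<bar>w \<bullet> n\<bar>" for w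
  proof
    assume "r u + w \<in> frontier \<Omega>"
    then obtain x where x: "r u + w = r x" "norm (x - u) < d"
      using e[of "r u + w"] w(2) by (auto simp: dist_norm norm_minus_commute)
    define h R where "h = x - u" and "R = r x - r u - r' h"
    have R: "norm R \<le> \<epsilon> * norm h" using d[OF x(2)] by (simp add: R_def h_def)
    have w_eq: "w = r' h + R" using x(1) by (simp add: R_def algebra_simps)
    have "\<kappa> * norm h \<le> norm w + norm R"
      using \<kappa>[of h] norm_triangle_ineq4[of w R] by (simp add: w_eq)
    also have "norm R \<le> \<kappa> / 2 * norm h"
      using R \<epsilon>(2) by (meson mult_right_mono norm_ge_zero order_trans)
    finally have h: "\<kappa> * norm h \<le> 2 * norm w" by simp
    have "\<bar>w \<bullet> n\<bar> = \<bar>R \<bullet> n\<bar>" by (simp add: w_eq inner_add_left normal)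
    also have "\<dots> \<le> norm R * norm n" by (rule Cauchy_Schwarz_ineq2)
    also have "\<dots> \<le> \<epsilon> * norm h * norm n" using R by (simp add: mult_right_mono)
    also have "\<dots> = (\<epsilon> * norm n) * norm h" by simp
    also have "\<dots> \<le> c * \<kappa> / 4 * norm h" using \<epsilon>(3) by (rule mult_right_mono) simp
    also have "\<dots> = c / 4 * (\<kappa> * norm h)" by simp
    also have "\<dots> \<le> c / 4 * (2 * norm w)" using h \<open>c > 0\<close> by (intro mult_left_mono) auto
    finally have "c * norm w \<le> c / 2 * norm w" using w(3) by simp
    then show False using \<open>c > 0\<close> w(1) by (simp add: field_simps)
  qed
  \<comment> \<open>The strict inequality excludes the apex \<open>w = 0\<close>; without it this
    half of the cone is still convex, hence connected.\<close>
  define K where "K = {w. norm w < e \<and> c * norm w \<le> w \<bullet> n \<and> 0 < w \<bullet> n}"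
  have "convex K"
  proof -
    have "convex {w. c * norm w \<le> w \<bullet> n}"
    proof (rule convexI)
      fix x y :: 'b and a b :: real
      assume *: "x \<in> {w. c * norm w \<le> w \<bullet> n}" "y \<in> {w. c * norm w \<le> w \<bullet> n}" "0 \<le> a" "0 \<le> b" "a + b = 1"
      have "c * norm (a *\<^sub>R x + b *\<^sub>R y) \<le> c * (a * norm x + b * norm y)"
        using norm_triangle_ineq[of "a *\<^sub>R x" "b *\<^sub>R y"] * \<open>c > 0\<close> by (intro mult_left_mono) auto
      also have "\<dots> = a * (c * norm x) + b * (c * norm y)" by (simp add: algebra_simps)
      also have "\<dots> \<le> a * (x \<bullet> n) + b * (y \<bullet> n)" using * by (intro add_mono mult_left_mono) auto
      finally show "a *\<^sub>R x + b *\<^sub>R y \<in> {w. c * norm w \<le> w \<bullet> n}" by (simp add: inner_add_left)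
    qed
    moreover have "convex {w. 0 < w \<bullet> n}"
      using convex_halfspace_gt[of 0 n] by (simp add: inner_commute)
    moreover have "K = ball 0 e \<inter> {w. c * norm w \<le> w \<bullet> n} \<inter> {w. 0 < w \<bullet> n}"
      by (auto simp: K_def)
    ultimately show ?thesis by (simp add: convex_Int)
  qed
  have conn: "connected ((\<lambda>w. r u + w) ` K)" "connected ((\<lambda>w. r u - w) ` K)"
    by (rule connected_continuous_image;
        use convex_connected[OF \<open>convex K\<close>] in \<open>simp add: continuous_intros\<close>)+
  have miss': "(\<lambda>w. r u + w) ` K \<inter> frontier \<Omega> = {}" "(\<lambda>w. r u - w) ` K \<inter> frontier \<Omega> = {}"
  proof -
    have "r u + w \<notin> frontier \<Omega> \<and> r u - w \<notin> frontier \<Omega>" if "w \<in> K" for w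
    proof -
      have "w \<noteq> 0" "norm w < e" "c * norm w \<le> \<bar>w \<bullet> n\<bar>"
        using that by (auto simp: K_def)
      then show ?thesis
        using miss[of w] miss[of "- w"] by simp
    qed
    then show "(\<lambda>w. r u + w) ` K \<inter> frontier \<Omega> = {}" "(\<lambda>w. r u - w) ` K \<inter> frontier \<Omega> = {}"
      by blast+
  qed
  \<comment> \<open>For \<open>0 < t < \<delta>\<close> both \<open>t *\<^sub>R v\<close> and
    \<open>t *\<^sub>R n\<close> are shorter than \<open>e\<close>.\<close>
  define \<delta> where "\<delta> = e / (norm v + norm n)"
  have "norm v + norm n > 0" using \<open>v \<noteq> 0\<close> by (simp add: add_pos_nonneg)
  then have "\<delta> > 0" using \<open>e > 0\<close> by (simp add: \<delta>_def)
  have inK: "t *\<^sub>R v \<in> K" "t *\<^sub>R n \<in> K" if "0 < t" "t < \<delta>" for t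
  proof -
    have "t * (norm v + norm n) < e"
      using that \<open>norm v + norm n > 0\<close> by (simp add: \<delta>_def field_simps)
    then have "t * norm v < e" "t * norm n < e"
      using that by (auto simp: distrib_left intro: le_less_trans[rotated])
    moreover have "c * norm v \<le> v \<bullet> n" "c * norm n \<le> n \<bullet> n"
    proof -
      have "c \<le> v \<bullet> n / norm v" "c \<le> norm n" by (auto simp: c_def)
      then show "c * norm v \<le> v \<bullet> n" "c * norm n \<le> n \<bullet> n"
        using \<open>v \<noteq> 0\<close> mult_right_mono[of c "norm n" "norm n"]
        by (auto simp: field_simps power2_norm_eq_inner[symmetric] power2_eq_square)
    qed
    ultimately show "t *\<^sub>R v \<in> K" "t *\<^sub>R n \<in> K"
      using that \<open>v \<bullet> n > 0\<close> \<open>n \<noteq> 0\<close> by (auto simp: K_def mult.left_commute[of c])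
  qed
  \<comment> \<open>A single point on the normal decides on which side each half of the cone lies,
    and thereby the side of \<open>t *\<^sub>R v\<close>.\<close>
  obtain t where t: "0 < t" "t < \<delta>" "r u + t *\<^sub>R n \<notin> closure \<Omega>" "r u - t *\<^sub>R n \<in> \<Omega>"
    using eventually_happens[OF eventually_conj[OF out eventually_at_right_real[OF \<open>\<delta> > 0\<close>]]] by auto
  have "(\<lambda>w. r u + w) ` K \<inter> \<Omega> = {}"
  proof (rule ccontr)
    assume "(\<lambda>w. r u + w) ` K \<inter> \<Omega> \<noteq> {}"
    moreover have "(\<lambda>w. r u + w) ` K - \<Omega> \<noteq> {}"
      using inK(2)[OF t(1,2)] t(3) closure_subset[of \<Omega>] by blast
    ultimately show False
      using connected_Int_frontier[OF conn(1)] miss'(1) by blast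
  qed
  then have outside: "r u + w \<notin> closure \<Omega>" if "w \<in> K" for w
    using that miss'(1) by (auto simp: closure_Un_frontier)
  have inside: "r u - w \<in> \<Omega>" if "w \<in> K" for w
  proof (rule ccontr)
    assume "r u - w \<notin> \<Omega>"
    then have "(\<lambda>w. r u - w) ` K - \<Omega> \<noteq> {}" using that by blast
    moreover have "(\<lambda>w. r u - w) ` K \<inter> \<Omega> \<noteq> {}"
      using inK(2)[OF t(1,2)] t(4) by blast
    ultimately show False
      using connected_Int_frontier[OF conn(2)] miss'(2) by blast
  qed
  show ?thesis
    using eventually_at_right_real[OF \<open>\<delta> > 0\<close>]
    by (rule eventually_mono) (use inK(1) outside inside in auto)
qed

section \<open>Lines parallel to a coordinate axis\<close>

text \<open>Such a map only relabels coordinates: preimages of boxes are boxes with the same side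
  lengths, and Lebesgue measure is determined by its values on boxes. It serves to identify
  \<open>(real^2) \<times> real\<close> with \<open>real^3\<close>, and \<open>real^2\<close> with
  \<open>real \<times> real\<close>.\<close>

lemma lborel_distr_Basis_bij:
  fixes f :: "'a::euclidean_space \<Rightarrow> 'b::euclidean_space"
  assumes "linear f" and bij: "bij_betw f Basis Basis"
  shows "distr lborel borel f = lborel"
proof (rule lborel_eqI[symmetric])
  interpret linear f by fact
  have [measurable]: "f \<in> borel_measurable borel"
    by (intro borel_measurable_continuous_onI linear_continuous_on)
       (simp add: \<open>linear f\<close> linear_linear)
  have inner_f: "f x \<bullet> f b = x \<bullet> b" if "b \<in> Basis" for x b
  proof -
    have "f x = (\<Sum>c\<in>Basis. (x \<bullet> c) *\<^sub>R f c)"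
      by (subst euclidean_representation[of x, symmetric]) (simp add: sum scaleR)
    also have "\<dots> \<bullet> f b = (\<Sum>c\<in>Basis. if c = b then x \<bullet> c else 0)"
      unfolding inner_sum_left
    proof (intro sum.cong refl)
      fix c :: 'a assume "c \<in> Basis"
      then have "f c \<bullet> f b = (if c = b then 1 else 0)"
        using bij that by (subst inner_Basis) (auto simp: bij_betw_def inj_on_eq_iff)
      then show "((x \<bullet> c) *\<^sub>R f c) \<bullet> f b = (if c = b then x \<bullet> c else 0)"
        by simp
    qed
    finally show ?thesis using that by simp
  qed
  fix l u :: 'b assume le: "\<And>b. b \<in> Basis \<Longrightarrow> l \<bullet> b \<le> u \<bullet> b"
  \<comment> \<open>\<open>g\<close> is the adjoint of \<open>f\<close>; it supplies the corners of
    the preimage box.\<close>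
  define g where "g z = (\<Sum>b\<in>Basis. (z \<bullet> f b) *\<^sub>R b)" for z
  have g: "g z \<bullet> b = z \<bullet> f b" if "b \<in> Basis" for z b
    using that by (simp add: g_def inner_sum_left inner_Basis if_distrib cong: if_cong)
  have fB: "f ` Basis = Basis" and inj: "inj_on f Basis"
    using bij by (auto simp: bij_betw_def)
  have "f -` box l u = box (g l) (g u)"
  proof -
    have "x \<in> f -` box l u \<longleftrightarrow> x \<in> box (g l) (g u)" for x
      unfolding vimage_eq mem_box fB[symmetric] using g inner_f by auto
    then show ?thesis by blast
  qed
  then have "emeasure (distr lborel borel f) (box l u) = emeasure lborel (box (g l) (g u))"
    by (subst emeasure_distr) auto
  also have "\<dots> = (\<Prod>b\<in>Basis. (g u - g l) \<bullet> b)"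
    using le fB by (intro emeasure_lborel_box) (auto simp: g)
  also have "\<dots> = (\<Prod>b\<in>Basis. (u - l) \<bullet> f b)"
    by (intro arg_cong[of _ _ ennreal] prod.cong) (auto simp: g inner_diff_left)
  also have "\<dots> = (\<Prod>b\<in>Basis. (u - l) \<bullet> b)"
    using prod.reindex[OF inj, of "\<lambda>b. (u - l) \<bullet> b"] by (simp add: fB)
  finally show "emeasure (distr lborel borel f) (box l u) = (\<Prod>b\<in>Basis. (u - l) \<bullet> b)" .
qed simp

text \<open>Arithmetic in the type \<open>3\<close> is modulo 3, so \<open>m\<close>,
  \<open>m + 1\<close>, \<open>m + 2\<close> run through all coordinates in cyclic order. This
  allows a uniform treatment of the three directions.\<close>

lemma cyclic_index_3:
  fixes m :: 3
  shows "m + 1 \<noteq> m" "m + 2 \<noteq> m" "m + 2 \<noteq> m + 1" "i = m \<or> i = m + 1 \<or> i = m + 2"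
proof -
  have "(1::3) + 1 = 2" "(1::3) + 2 = 3" "(2::3) + 1 = 3" "(2::3) + 2 = 1" "(3::3) + 1 = 1" "(3::3) + 2 = 2"
    by simp_all
  then show "m + 1 \<noteq> m" "m + 2 \<noteq> m" "m + 2 \<noteq> m + 1" "i = m \<or> i = m + 1 \<or> i = m + 2"
    using exhaust_3[of m] exhaust_3[of i] by auto
qed

lemma UNIV_cyclic_3: "(UNIV :: 3 set) = {m, m + 1, m + 2}"
  using cyclic_index_3(4)[of _ m] by auto

text \<open>The two remaining coordinates are kept in cyclic order, so that the Jacobian of a
  projected patch is the \<open>m\<close>-th component of its normal with the correct sign.\<close>

definition proj_along :: "3 \<Rightarrow> real^3 \<Rightarrow> real^2"
  where "proj_along m p = (\<chi> i. if i = 1 then p $ (m + 1) else p $ (m + 2))"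

definition on_line :: "3 \<Rightarrow> real^2 \<Rightarrow> real \<Rightarrow> real^3"
  where "on_line m y t = (\<chi> i. if i = m then t else if i = m + 1 then y $ 1 else y $ 2)"

lemma proj_along_nth [simp]: "proj_along m p $ 1 = p $ (m + 1)" "proj_along m p $ 2 = p $ (m + 2)"
  by (simp_all add: proj_along_def)

lemma on_line_nth [simp]:
  "on_line m y t $ m = t" "on_line m y t $ (m + 1) = y $ 1" "on_line m y t $ (m + 2) = y $ 2"
  using cyclic_index_3[of m] by (simp_all add: on_line_def)

lemma vec3_eq_cyclic:
  fixes p q :: "'a^3"
  shows "p = q \<longleftrightarrow> p $ m = q $ m \<and> p $ (m + 1) = q $ (m + 1) \<and> p $ (m + 2) = q $ (m + 2)"
proof
  assume *: "p $ m = q $ m \<and> p $ (m + 1) = q $ (m + 1) \<and> p $ (m + 2) = q $ (m + 2)"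
  have "p $ i = q $ i" for i
    using cyclic_index_3(4)[of i m] * by (elim disjE) simp_all
  then show "p = q"
    by (simp add: vec_eq_iff)
qed simp

lemma proj_along_on_line [simp]: "proj_along m (on_line m y t) = y"
  by (simp add: vec_eq_iff forall_2)

lemma on_line_proj_along [simp]: "on_line m (proj_along m p) (p $ m) = p"
  by (simp add: vec3_eq_cyclic[of _ _ m])

lemma on_line_add: "on_line m y (t + s) = on_line m y t + s *\<^sub>R axis m 1"
  using cyclic_index_3[of m] by (simp add: vec3_eq_cyclic[of _ _ m] axis_def)

lemma linear_proj_along: "linear (proj_along m)"
  by (rule linearI) (simp_all add: vec_eq_iff forall_2)

lemma linear_on_line: "linear (\<lambda>z. on_line m (fst z) (snd z))"
  by (rule linearI) (simp_all add: vec3_eq_cyclic[of _ _ m])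

lemma continuous_on_on_line: "continuous_on A (on_line m y)"
proof -
  have "continuous_on A (\<lambda>t. (\<lambda>z. on_line m (fst z) (snd z)) (y, t))"
    by (rule continuous_on_compose2[OF linear_continuous_on[OF linear_on_line[unfolded linear_conv_bounded_linear], of UNIV]])
      (auto intro: continuous_intros)
  then show ?thesis by simp
qed

lemma distr_on_line: "distr lborel borel (\<lambda>z. on_line m (fst z) (snd z)) = lborel"
proof (rule lborel_distr_Basis_bij[OF linear_on_line])
  let ?f = "\<lambda>z. on_line m (fst z) (snd z)"
  have B: "Basis = {(axis 1 1 :: real^2, 0 :: real), (axis 2 1, 0), (0, 1)}"
    by (auto simp: Basis_prod_def Basis_vec_def UNIV_2)
  have f: "?f (axis 1 1, 0) = axis (m + 1) 1" "?f (axis 2 1, 0) = axis (m + 2) 1" "?f (0, 1) = axis m 1"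
    using cyclic_index_3[of m] by (auto simp: vec3_eq_cyclic[of _ _ m] axis_def)
  have "?f ` Basis = Basis"
    unfolding B image_insert image_empty f by (auto simp: Basis_vec_def UNIV_cyclic_3[of m])
  moreover have "inj_on ?f Basis"
    unfolding B inj_on_def using cyclic_index_3[of m] f by (auto simp: axis_eq_axis)
  ultimately show "bij_betw ?f Basis Basis"
    by (simp add: bij_betw_def)
qed

lemma Fubini_along:
  fixes g :: "real^3 \<Rightarrow> real"
  assumes "integrable lborel g"
  shows "integrable lborel (\<lambda>y. LINT t|lborel. g (on_line m y t))"
    and "(LINT y|lborel. LINT t|lborel. g (on_line m y t)) = integral\<^sup>L lborel g"
proof -
  let ?f = "\<lambda>z. on_line m (fst z) (snd z)"
  have f: "?f \<in> borel_measurable (borel :: ((real^2) \<times> real) measure)"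
    using linear_on_line by (intro borel_measurable_continuous_onI linear_continuous_on)
      (simp add: linear_conv_bounded_linear)
  have g: "g \<in> borel_measurable borel"
    using assms by auto
  have int: "integrable (lborel \<Otimes>\<^sub>M lborel) (\<lambda>z. g (?f z))"
    using assms f g integrable_distr_eq[of ?f lborel borel g]
    by (simp add: lborel_prod distr_on_line)
  show "integrable lborel (\<lambda>y. LINT t|lborel. g (on_line m y t))"
    using lborel_pair.integrable_fst'[OF int] by simp
  have "(LINT y|lborel. LINT t|lborel. g (on_line m y t)) = (LINT z|lborel. g (?f z))"
    using lborel_pair.integral_fst'[OF int] by (simp add: lborel_prod)
  also have "\<dots> = integral\<^sup>L lborel g"
    using f g integral_distr[of ?f lborel borel g] by (simp add: distr_on_line)
  finally show "(LINT y|lborel. LINT t|lborel. g (on_line m y t)) = integral\<^sup>L lborel g" .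
qed

lemma cross3_cyclic: "cross3 a b $ m = a $ (m + 1) * b $ (m + 2) - a $ (m + 2) * b $ (m + 1)"
proof -
  consider "m = 1" "m + 1 = 2" "m + 2 = 3" | "m = 2" "m + 1 = 3" "m + 2 = 1" | "m = 3" "m + 1 = 1" "m + 2 = 2"
    using exhaust_3[of m] by force
  then show ?thesis
    by cases (simp_all only:, simp_all add: cross3_def)
qed

section \<open>The divergence theorem\<close>

text \<open>The normal of a patch with derivative \<open>L\<close>. Parameters are taken in
  \<open>real^2\<close>, so that the projected patch maps \<open>real^2\<close> to itself and its
  derivative has a determinant.\<close>

abbreviation normal_of :: "(real^2 \<Rightarrow> real^3) \<Rightarrow> real^3"
  where "normal_of L \<equiv> cross3 (L (axis 1 1)) (L (axis 2 1))"

lemma vec2_expand: "v = (v $ 1) *\<^sub>R axis 1 1 + (v $ 2) *\<^sub>R axis 2 (1::real)"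
  for v :: "real^2"
  by (simp add: vec_eq_iff forall_2 axis_def)

lemma normal_of_orthogonal:
  assumes "linear L"
  shows "L h \<bullet> normal_of L = 0"
proof -
  interpret linear L by fact
  show ?thesis
    by (subst vec2_expand[of h]) (simp add: add scaleR inner_add_left dot_cross_self)
qed

text \<open>The cross product of \<open>L h\<close> with one column eliminates that column, so
  \<open>L h = 0\<close> forces each coefficient of \<open>h\<close> to vanish.\<close>

lemma inj_if_normal_of_nonzero:
  assumes "linear L" "normal_of L \<noteq> 0"
  shows "inj L"
proof -
  interpret linear L by fact
  have "h = 0" if "L h = 0" for h
  proof -
    let ?a = "L (axis 1 1)" and ?b = "L (axis 2 1)"
    have L: "h $ 1 *\<^sub>R ?a + h $ 2 *\<^sub>R ?b = 0"
      using that by (subst (asm) vec2_expand[of h]) (simp add: add scaleR)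
    have "h $ 1 *\<^sub>R normal_of L = cross3 (h $ 1 *\<^sub>R ?a + h $ 2 *\<^sub>R ?b) ?b"
      by (simp add: cross_add_left cross_mult_left)
    then have 1: "h $ 1 = 0" using assms(2) by (simp add: L)
    have "h $ 2 *\<^sub>R normal_of L = cross3 ?a (h $ 1 *\<^sub>R ?a + h $ 2 *\<^sub>R ?b)"
      by (simp add: cross_add_right cross_mult_right)
    then have "h $ 2 = 0" using assms(2) by (simp add: L)
    with 1 show ?thesis by (simp add: vec_eq_iff forall_2)
  qed
  then show ?thesis
    by (simp add: linear_injective_0[OF assms(1)])
qed

lemma det_proj_along: "det (matrix (\<lambda>h. proj_along m (L h))) = normal_of L $ m"
  by (simp add: det_2 matrix_def cross3_cyclic[of _ _ m] mult_ac)

text \<open>The surface without the image of the parameters near \<open>u\<close> on patch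
  \<open>i\<close> is compact and, by \<open>inj\<close>, misses \<open>r i u\<close>; so it stays
  at a positive distance. This supplies the hypothesis \<open>loc\<close> of
  \<open>sides_along_transversal\<close>.\<close>

lemma patch_local:
  fixes r :: "nat \<Rightarrow> 'a::euclidean_space \<Rightarrow> 'b::euclidean_space"
  assumes "\<And>i. i < k \<Longrightarrow> bounded (G i)"
    and "\<And>i. i < k \<Longrightarrow> continuous_on (closure (G i)) (r i)"
    and inj: "\<And>i j u v. i < k \<Longrightarrow> j < k \<Longrightarrow> u \<in> G i \<Longrightarrow> v \<in> closure (G j) \<Longrightarrow> r i u = r j v \<Longrightarrow> i = j \<and> u = v"
    and i: "i < k" "u \<in> G i" and "d > 0"
  shows "\<exists>e>0. \<forall>q\<in>(\<Union>j<k. r j ` closure (G j)). dist q (r i u) < e \<longrightarrow> q \<in> r i ` ball u d"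
proof -
  define Z where "Z = (\<Union>j<k. r j ` (closure (G j) - (if j = i then ball u d else {})))"
  have "compact (r j ` (closure (G j) - (if j = i then ball u d else {})))" if "j < k" for j
    using assms(1,2)[OF that]
    by (intro compact_continuous_image compact_diff)
      (auto intro: continuous_on_subset simp: compact_closure)
  then have "compact Z"
    unfolding Z_def by (intro compact_UN) auto
  moreover have "r i u \<notin> Z"
  proof
    assume "r i u \<in> Z"
    then obtain j v where j: "j < k" "v \<in> closure (G j)" "v \<notin> (if j = i then ball u d else {})" "r i u = r j v"
      unfolding Z_def by blast
    then have "i = j \<and> u = v" using inj[OF i(1) j(1) i(2)] by blast
    with j(3) \<open>d > 0\<close> show False by (auto split: if_splits)
  qed
  ultimately obtain e where e: "e > 0" "ball (r i u) e \<subseteq> - Z"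
    using open_contains_ball[of "- Z"] by (auto dest: compact_imp_closed)
  have "q \<in> r i ` ball u d" if q: "q \<in> (\<Union>j<k. r j ` closure (G j))" "dist q (r i u) < e" for q
  proof -
    obtain j v where j: "j < k" "v \<in> closure (G j)" "q = r j v"
      using q(1) by blast
    have "q \<notin> Z" using e(2) q(2) by (auto simp: dist_commute subset_iff)
    then have "v \<in> (if j = i then ball u d else {})"
      unfolding Z_def using j by blast
    then show ?thesis
      using j by (auto split: if_splits)
  qed
  with e(1) show ?thesis by blast
qed

text \<open>The patches are differentiable on the closed parameter domains, so the edges project to
  null sets and the surface integrand is continuous on a compact set.\<close>

theorem divergence_theorem_component:
  fixes r :: "nat \<Rightarrow> real^2 \<Rightarrow> real^3" and r' :: "nat \<Rightarrow> real^2 \<Rightarrow> real^2 \<Rightarrow> real^3"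
    and f D :: "real^3 \<Rightarrow> real"
  assumes "open \<Omega>" "bounded \<Omega>"
    and G: "\<And>i. i < k \<Longrightarrow> open (G i)" "\<And>i. i < k \<Longrightarrow> bounded (G i)"
      "\<And>i. i < k \<Longrightarrow> negligible (closure (G i) - G i)"
    and der: "\<And>i u. i < k \<Longrightarrow> u \<in> closure (G i) \<Longrightarrow> (r i has_derivative r' i u) (at u)"
    and contr': "\<And>i h. i < k \<Longrightarrow> continuous_on (closure (G i)) (\<lambda>u. r' i u h)"
    and reg: "\<And>i u. i < k \<Longrightarrow> u \<in> G i \<Longrightarrow> normal_of (r' i u) \<noteq> 0"
    and front: "frontier \<Omega> = (\<Union>i<k. r i ` closure (G i))"
    and inj: "\<And>i j u v. i < k \<Longrightarrow> j < k \<Longrightarrow> u \<in> G i \<Longrightarrow> v \<in> closure (G j) \<Longrightarrow> r i u = r j v \<Longrightarrow> i = j \<and> u = v"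
    and out: "\<And>i u. i < k \<Longrightarrow> u \<in> G i \<Longrightarrow> \<forall>\<^sub>F t in at_right 0.
      r i u + t *\<^sub>R normal_of (r' i u) \<notin> closure \<Omega> \<and> r i u - t *\<^sub>R normal_of (r' i u) \<in> \<Omega>"
    and contf: "continuous_on (closure \<Omega>) f" and contD: "continuous_on (closure \<Omega>) D"
    and partial: "\<And>p. p \<in> \<Omega> \<Longrightarrow> ((\<lambda>t. f (p + t *\<^sub>R axis m 1)) has_vector_derivative D p) (at 0)"
  shows "(LINT p:\<Omega>|lborel. D p) = (\<Sum>i<k. LINT u:G i|lborel. f (r i u) * normal_of (r' i u) $ m)"
proof -
  define J where "J i u = normal_of (r' i u) $ m" for i u
  define \<phi> where "\<phi> i u = proj_along m (r i u)" for i u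
  define \<phi>' where "\<phi>' i u h = proj_along m (r' i u h)" for i u h
  define g where "g i u = f (r i u)" for i u
  define N where "N i y = {u\<in>G i. \<phi> i u = y \<and> J i u \<noteq> 0}" for i y
  have det: "det (matrix (\<phi>' i u)) = J i u" for i u
    unfolding J_def \<phi>'_def[abs_def] by (rule det_proj_along)
  have blin: "bounded_linear (proj_along m)"
    using linear_proj_along by (simp add: linear_conv_bounded_linear)
  have der\<phi>: "(\<phi> i has_derivative \<phi>' i u) (at u)" if "i < k" "u \<in> closure (G i)" for i u
    unfolding \<phi>_def[abs_def] \<phi>'_def[abs_def] using der[OF that]
    by (rule bounded_linear.has_derivative[OF blin])
  have cont\<phi>': "continuous_on (closure (G i)) (\<lambda>u. \<phi>' i u h)" if "i < k" for i h
    unfolding \<phi>'_def using contr'[OF that] by (rule bounded_linear.continuous_on[OF blin])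
  have contr: "continuous_on (closure (G i)) (r i)" if "i < k" for i
    using der[OF that] by (meson continuous_at_imp_continuous_on has_derivative_continuous)
  have sub: "G i \<subseteq> closure (G i)" for i
    by (rule closure_subset)
  have contg: "continuous_on (closure (G i)) (g i)" if "i < k" for i
    unfolding g_def using contf contr[OF that] front that
    by (intro continuous_on_compose2[OF contf]) (auto simp: closure_Un_frontier)
  have contJ: "continuous_on (closure (G i)) (J i)" if "i < k" for i
    using continuous_on_det_matrix[of "closure (G i)" "\<phi>' i"] cont\<phi>'[OF that] by (simp add: det)
  have intborel: "set_integrable lborel (G i) (\<lambda>u. g i u * J i u)" if "i < k" for i
  proof (rule set_integrable_subset)
    show "set_integrable lborel (closure (G i)) (\<lambda>u. g i u * J i u)"
      unfolding set_integrable_def using G(2) contg contJ that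
      by (intro borel_integrable_compact continuous_intros) (auto simp: compact_closure)
  qed (use G(1) that sub in auto)
  have int: "set_integrable lebesgue (G i) (\<lambda>u. g i u * det (matrix (\<phi>' i u)))"
    "(LINT u:G i|lebesgue. g i u * det (matrix (\<phi>' i u))) = (LINT u:G i|lborel. g i u * J i u)"
    if "i < k" for i
    using intborel[OF that] unfolding det set_integrable_def set_lebesgue_integral_def
    by (auto simp: integrable_completion integral_completion)
  \<comment> \<open>The line over a good \<open>y\<close> meets the surface only off the edges, and
    there never tangentially.\<close>
  define good where "good y \<longleftrightarrow> (\<forall>i<k. y \<notin> \<phi> i ` (closure (G i) - G i) \<and> y \<notin> \<phi> i ` {u\<in>G i. J i u = 0})" for y
  have AEgood: "AE y in lebesgue. good y"
  proof -
    have "negligible (\<phi> i ` (closure (G i) - G i))" if "i < k" for i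
      using G(3)[OF that] der\<phi>[OF that]
      by (intro negligible_differentiable_image_negligible)
        (auto simp: differentiable_on_def intro: differentiableI has_derivative_at_withinI)
    moreover have "negligible (\<phi> i ` {u\<in>G i. J i u = 0})" if "i < k" for i
    proof (rule baby_Sard)
      show "(\<phi> i has_derivative \<phi>' i u) (at u within {u\<in>G i. J i u = 0})" if "u \<in> {u\<in>G i. J i u = 0}" for u
        using der\<phi>[OF \<open>i < k\<close>, of u] that sub[of i] by (auto intro: has_derivative_at_withinI)
      show "rank (matrix (\<phi>' i u)) < CARD(2)" if "u \<in> {u\<in>G i. J i u = 0}" for u
        using that det_eq_0_rank[of "matrix (\<phi>' i u)"] det[of i u] by auto
    qed simp
    ultimately have "negligible (\<Union>i<k. \<phi> i ` (closure (G i) - G i) \<union> \<phi> i ` {u\<in>G i. J i u = 0})"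
      by (intro negligible_Union) auto
    then show ?thesis
      by (intro AE_I'[of "\<Union>i<k. \<phi> i ` (closure (G i) - G i) \<union> \<phi> i ` {u\<in>G i. J i u = 0}"])
        (auto simp: negligible_iff_null_sets good_def)
  qed
  have line: "(\<forall>i<k. finite (N i y)) \<and>
      (LINT t:{t. on_line m y t \<in> \<Omega>}|lborel. D (on_line m y t)) = (\<Sum>i<k. \<Sum>u\<in>N i y. g i u * sgn (J i u))"
    if "good y" for y
  proof -
    define W where "W = {t. on_line m y t \<in> \<Omega>}"
    define C where "C = {t. on_line m y t \<in> closure \<Omega>}"
    \<comment> \<open>\<open>X\<close> lists the boundary points on the line as pairs of a patch
      index and a parameter, and \<open>\<psi>\<close> gives their heights. As patches overlap at
      most along edges, \<open>\<psi>\<close> is injective on \<open>X\<close>.\<close>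
    define X where "X = (SIGMA i:{..<k}. N i y)"
    define \<psi> where "\<psi> x = r (fst x) (snd x) $ m" for x
    have W: "W = on_line m y -` \<Omega>" and C: "C = on_line m y -` closure \<Omega>"
      by (auto simp: W_def C_def)
    have "open W"
      unfolding W using \<open>open \<Omega>\<close> continuous_on_on_line by (rule open_vimage)
    have "W \<subseteq> C"
      unfolding W C using closure_subset by blast
    have "compact C"
    proof -
      obtain B where "\<And>p. p \<in> closure \<Omega> \<Longrightarrow> norm p \<le> B"
        using bounded_closure[OF \<open>bounded \<Omega>\<close>] unfolding bounded_iff by blast
      then have "\<bar>t\<bar> \<le> B" if "t \<in> C" for t
        using that component_le_norm_cart[of "on_line m y t" m] by (force simp: C_def)
      then have "bounded C" by (auto simp: bounded_iff)
      moreover have "closed C"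
        unfolding C using closed_closure continuous_on_on_line by (rule closed_vimage)
      ultimately show ?thesis by (simp add: compact_eq_bounded_closed)
    qed
    have CW: "t \<in> C - W \<longleftrightarrow> on_line m y t \<in> frontier \<Omega>" for t
      using \<open>open \<Omega>\<close> by (auto simp: C_def W_def frontier_def interior_open)
    have NX: "r i u = on_line m y (\<psi> (i, u))" if "(i, u) \<in> X" for i u
      using that on_line_proj_along[of m "r i u"] by (simp add: X_def N_def \<phi>_def \<psi>_def)
    have bij: "bij_betw \<psi> X (C - W)"
    proof (rule bij_betw_imageI)
      show "inj_on \<psi> X"
      proof (rule inj_onI)
        fix x x' assume x: "x \<in> X" "x' \<in> X" "\<psi> x = \<psi> x'"
        obtain i u j v where ij: "x = (i, u)" "x' = (j, v)" by fastforce
        have "r i u = r j v" using NX x unfolding ij by metis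
        then show "x = x'"
          using inj[of i j u v] x sub[of j] unfolding ij by (auto simp: X_def N_def)
      qed
      show "\<psi> ` X = C - W"
      proof (intro equalityI subsetI)
        fix t assume "t \<in> \<psi> ` X"
        then obtain i u where iu: "(i, u) \<in> X" "t = \<psi> (i, u)" by auto
        have "r i u \<in> frontier \<Omega>"
          using iu(1) sub[of i] by (auto simp: front X_def N_def)
        then show "t \<in> C - W"
          using NX[OF iu(1)] iu(2) CW by simp
      next
        fix t assume "t \<in> C - W"
        then obtain i u where iu: "i < k" "u \<in> closure (G i)" "on_line m y t = r i u"
          unfolding CW front by blast
        then have y: "y = \<phi> i u" by (metis \<phi>_def proj_along_on_line)
        have "u \<in> G i" "J i u \<noteq> 0"
          using \<open>good y\<close> iu(1,2) y unfolding good_def by blast+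
        then have "(i, u) \<in> X" using iu(1) y by (simp add: X_def N_def)
        moreover have "t = \<psi> (i, u)" by (simp add: \<psi>_def iu(3)[symmetric])
        ultimately show "t \<in> \<psi> ` X" by blast
      qed
    qed
    define \<sigma> where "\<sigma> t = (case inv_into X \<psi> t of (i, u) \<Rightarrow> sgn (J i u))" for t
    have \<sigma>\<psi>: "\<sigma> (\<psi> (i, u)) = sgn (J i u)" if "(i, u) \<in> X" for i u
      using bij_betw_inv_into_left[OF bij that] by (simp add: \<sigma>_def)
    have sides: "(\<sigma> t = 1 \<or> \<sigma> t = -1) \<and> (\<forall>\<^sub>F \<delta> in at_right 0. t + \<sigma> t * \<delta> \<notin> C \<and> t - \<sigma> t * \<delta> \<in> W)"
      if "t \<in> C - W" for t
    proof -
      have "t \<in> \<psi> ` X"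
        using that bij_betw_imp_surj_on[OF bij] by blast
      then obtain i u where iu: "(i, u) \<in> X" "t = \<psi> (i, u)"
        by auto
      then have i: "i < k" "u \<in> G i" "J i u \<noteq> 0" by (auto simp: X_def N_def)
      have st: "\<sigma> t = sgn (J i u)" using \<sigma>\<psi> iu by simp
      have p: "r i u = on_line m y t" using NX iu by simp
      have u: "u \<in> closure (G i)" using i(2) sub by blast
      have lin: "linear (r' i u)" using der[OF i(1) u] by (rule has_derivative_linear)
      \<comment> \<open>The vector \<open>\<sigma> t *\<^sub>R axis m 1\<close> has inner product
        \<open>\<bar>J i u\<bar> > 0\<close> with the normal, so it leaves the region on the same
        side as the normal.\<close>
      have "\<forall>\<^sub>F \<delta> in at_right 0. r i u + \<delta> *\<^sub>R (\<sigma> t *\<^sub>R axis m 1) \<notin> closure \<Omega> \<and> r i u - \<delta> *\<^sub>R (\<sigma> t *\<^sub>R axis m 1) \<in> \<Omega>"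
      proof (rule sides_along_transversal[OF der[OF i(1) u] _ normal_of_orthogonal[OF lin] reg[OF i(1,2)]])
        show "inj (r' i u)"
          using lin reg[OF i(1,2)] by (rule inj_if_normal_of_nonzero)
        show "\<exists>e>0. \<forall>q\<in>frontier \<Omega>. dist q (r i u) < e \<longrightarrow> q \<in> r i ` ball u d" if "d > 0" for d
          unfolding front using G(2) contr inj i(1,2) that by (rule patch_local)
        show "0 < (\<sigma> t *\<^sub>R axis m 1) \<bullet> normal_of (r' i u)"
          using i(3) by (auto simp: st inner_axis' J_def sgn_if)
      qed (use out i in auto)
      then have "\<forall>\<^sub>F \<delta> in at_right 0. t + \<sigma> t * \<delta> \<notin> C \<and> t - \<sigma> t * \<delta> \<in> W"
        using on_line_add[of m y t] unfolding p C_def W_def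
        by (elim eventually_mono) (simp add: mult.commute, metis diff_conv_add_uminus scaleR_minus_left)
      then show ?thesis using i(3) by (auto simp: st sgn_if)
    qed
    have F: "((\<lambda>t. f (on_line m y t)) has_vector_derivative D (on_line m y t)) (at t)" if "t \<in> W" for t
    proof -
      have "((\<lambda>s. f (on_line m y (t + s))) has_vector_derivative D (on_line m y t)) (at 0)"
        using partial[of "on_line m y t"] that by (simp add: W_def on_line_add)
      then show ?thesis
        using DERIV_shift[of "\<lambda>t. f (on_line m y t)" "D (on_line m y t)" 0 t]
        by (simp add: has_real_derivative_iff_has_vector_derivative add.commute)
    qed
    have contline: "continuous_on C (\<lambda>t. h (on_line m y t))" if "continuous_on (closure \<Omega>) h" for h :: "real^3 \<Rightarrow> real"
      by (rule continuous_on_compose2[OF that continuous_on_on_line]) (auto simp: C_def)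
    note FTC = integral_derivative_open_set[OF \<open>open W\<close> \<open>compact C\<close> \<open>W \<subseteq> C\<close> contline[OF contf] contline[OF contD] F,
        of \<sigma>]
    have fin: "finite (C - W)"
      using FTC(1) sides by blast
    have finX: "finite X"
      using bij_betw_finite[OF bij] fin by blast
    have finN: "finite (N i y)" if "i < k" for i
    proof (rule finite_subset)
      show "N i y \<subseteq> snd ` X"
        using that by (force simp: X_def)
    qed (use finX in auto)
    have "(LINT t:W|lborel. D (on_line m y t)) = (\<Sum>t\<in>C - W. \<sigma> t * f (on_line m y t))"
      using FTC(2) sides by blast
    also have "\<dots> = (\<Sum>x\<in>X. \<sigma> (\<psi> x) * f (on_line m y (\<psi> x)))"
      by (rule sum.reindex_bij_betw[OF bij, symmetric])
    also have "\<dots> = (\<Sum>(i, u)\<in>X. g i u * sgn (J i u))"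
      using \<sigma>\<psi> NX by (intro sum.cong refl) (auto simp: g_def)
    also have "\<dots> = (\<Sum>i<k. \<Sum>u\<in>N i y. g i u * sgn (J i u))"
      unfolding X_def using finN by (intro sum.Sigma[symmetric]) auto
    finally show ?thesis
      using finN by (simp add: W_def)
  qed
  \<comment> \<open>What the area formula provides for patch \<open>i\<close>, bundled so that the
    functions \<open>H i\<close> can be chosen for all patches at once.\<close>
  define fibre where "fibre i H \<longleftrightarrow> integrable lebesgue H \<and>
      integral\<^sup>L lebesgue H = (LINT u:G i|lborel. g i u * J i u) \<and>
      (AE y in lebesgue. H y = (\<Sum>u\<in>N i y. g i u * sgn (J i u)))" for i and H :: "real^2 \<Rightarrow> real"
  have "\<exists>H. fibre i H" if i: "i < k" for i
  proof -
    \<comment> \<open>The finiteness required by the area formula is inherited from the finiteness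
      of the set of boundary points on a good line.\<close>
    have fin: "AE y in lebesgue. finite {u\<in>G i. \<phi> i u = y \<and> det (matrix (\<phi>' i u)) \<noteq> 0}"
      using AEgood by (rule eventually_mono) (use line i in \<open>simp add: det N_def\<close>)
    have d: "(\<phi> i has_derivative \<phi>' i u) (at u)" if "u \<in> G i" for u
      using der\<phi>[OF i] that sub by blast
    have c: "continuous_on (G i) (\<lambda>u. \<phi>' i u h)" for h
      using cont\<phi>'[OF i] sub by (rule continuous_on_subset)
    obtain H where "integrable lebesgue H"
      "integral\<^sup>L lebesgue H = (LINT u:G i|lebesgue. g i u * det (matrix (\<phi>' i u)))"
      "AE y in lebesgue. H y = (\<Sum>u | u \<in> G i \<and> \<phi> i u = y \<and> det (matrix (\<phi>' i u)) \<noteq> 0.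
          g i u * sgn (det (matrix (\<phi>' i u))))"
      by (rule area_formula[OF G(1)[OF i] d c int(1)[OF i] fin])
    then show ?thesis
      using int(2)[OF i] by (auto simp: fibre_def det N_def)
  qed
  then obtain H where "\<And>i. i < k \<Longrightarrow> fibre i (H i)"
    by metis
  then have H: "integrable lebesgue (H i)"
      "integral\<^sup>L lebesgue (H i) = (LINT u:G i|lborel. g i u * J i u)"
      "AE y in lebesgue. H i y = (\<Sum>u\<in>N i y. g i u * sgn (J i u))" if "i < k" for i
    using that unfolding fibre_def by blast+
  have intD: "integrable lborel (\<lambda>p. indicator \<Omega> p * D p)"
  proof -
    have "set_integrable lborel (closure \<Omega>) D"
      unfolding set_integrable_def using \<open>bounded \<Omega>\<close> contD
      by (intro borel_integrable_compact) (auto simp: compact_closure)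
    then have "set_integrable lborel \<Omega> D"
      by (rule set_integrable_subset) (use \<open>open \<Omega>\<close> closure_subset in auto)
    then show ?thesis by (simp add: set_integrable_def)
  qed
  define I where "I y = (LINT t|lborel. indicator \<Omega> (on_line m y t) * D (on_line m y t))" for y
  have I: "integrable lborel I" "integral\<^sup>L lborel I = (LINT p:\<Omega>|lborel. D p)"
    using Fubini_along[OF intD, of m] unfolding I_def[abs_def] by (simp_all add: set_lebesgue_integral_def)
  have I_line: "I y = (LINT t:{t. on_line m y t \<in> \<Omega>}|lborel. D (on_line m y t))" for y
    unfolding I_def set_lebesgue_integral_def
    by (intro Bochner_Integration.integral_cong) (auto simp: indicator_def)
  have AE_all: "AE y in lebesgue. \<forall>i\<in>{..<k}. H i y = (\<Sum>u\<in>N i y. g i u * sgn (J i u))"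
    using H(3) by (intro AE_finite_allI) auto
  \<comment> \<open>The area formula is stated for the completed measure, so the outer integral from
    Fubini is moved there before it is compared with the fibre sums.\<close>
  have "(LINT p:\<Omega>|lborel. D p) = integral\<^sup>L lebesgue I"
    using I by (simp add: integral_completion)
  also have "\<dots> = (LINT y|lebesgue. (\<Sum>i<k. H i y))"
  proof (rule integral_cong_AE)
    show "I \<in> borel_measurable lebesgue"
      using I(1) by (auto intro: measurable_completion)
    show "(\<lambda>y. \<Sum>i<k. H i y) \<in> borel_measurable lebesgue"
      using H(1) by (intro borel_measurable_sum) auto
    show "AE y in lebesgue. I y = (\<Sum>i<k. H i y)"
      using AEgood AE_all by eventually_elim (use line I_line in simp)
  qed
  also have "\<dots> = (\<Sum>i<k. integral\<^sup>L lebesgue (H i))"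
    using H(1) by (intro Bochner_Integration.integral_sum) auto
  also have "\<dots> = (\<Sum>i<k. LINT u:G i|lborel. f (r i u) * normal_of (r' i u) $ m)"
    using H(2) by (intro sum.cong refl) (simp add: g_def J_def)
  finally show ?thesis .
qed

section \<open>Passage between \<open>real^2\<close> and \<open>real \<times> real\<close> as
  parameter spaces\<close>

definition pair_of_vec2 :: "real^2 \<Rightarrow> real \<times> real"
  where "pair_of_vec2 v = (v $ 1, v $ 2)"

lemma linear_pair_of_vec2: "linear pair_of_vec2"
  by (rule linearI) (simp_all add: pair_of_vec2_def)

definition vec2_of_pair :: "real \<times> real \<Rightarrow> real^2"
  where "vec2_of_pair u = (\<chi> i. if i = 1 then fst u else snd u)"

lemma linear_vec2_of_pair: "linear vec2_of_pair"
  by (rule linearI) (simp_all add: vec2_of_pair_def vec_eq_iff)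

lemma pair_of_vec2_inverse: "pair_of_vec2 (vec2_of_pair u) = u" "vec2_of_pair (pair_of_vec2 v) = v"
  by (simp_all add: pair_of_vec2_def vec2_of_pair_def vec_eq_iff forall_2)

lemma bij_pair_of_vec2: "bij pair_of_vec2"
  by (rule bij_betw_byWitness[where f' = vec2_of_pair]) (simp_all add: pair_of_vec2_inverse)

lemma distr_pair_of_vec2: "distr lborel borel pair_of_vec2 = lborel"
proof (rule lborel_distr_Basis_bij[OF linear_pair_of_vec2])
  have B: "Basis = {axis 1 1, axis 2 1 :: real^2}" "Basis = {(1, 0), (0, 1) :: real \<times> real}"
    by (auto simp: Basis_vec_def UNIV_2 Basis_prod_def)
  have "pair_of_vec2 (axis 1 1) = (1, 0)" "pair_of_vec2 (axis 2 1) = (0, 1)"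
    by (simp_all add: pair_of_vec2_def axis_def)
  then have "pair_of_vec2 ` Basis = Basis"
    unfolding B by simp
  moreover have "inj_on pair_of_vec2 Basis"
    using bij_pair_of_vec2 by (meson bij_is_inj inj_on_subset subset_UNIV)
  ultimately show "bij_betw pair_of_vec2 Basis Basis"
    by (simp add: bij_betw_def)
qed

lemma smooth_patch_derivative:
  assumes "smooth_patch (G, r)"
  shows "u \<in> closure G \<Longrightarrow> (r has_derivative frechet_derivative r (at u)) (at u)"
    and "continuous_on (closure G) (\<lambda>u. frechet_derivative r (at u) h)"
    and "continuous_on (closure G) r" "continuous_on (closure G) (patch_normal r)"
proof -
  obtain U where U: "open U" "closure G \<subseteq> U" "r differentiable_on U"
    "\<And>h. continuous_on U (\<lambda>u. frechet_derivative r (at u) h)"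
    using assms unfolding smooth_patch_def by auto
  have diff: "r differentiable (at u)" if "u \<in> closure G" for u
    using U(1-3) that differentiable_on_eq_differentiable_at by blast
  then show "(r has_derivative frechet_derivative r (at u)) (at u)" if "u \<in> closure G" for u
    using that by (simp add: frechet_derivative_works)
  show cont: "continuous_on (closure G) (\<lambda>u. frechet_derivative r (at u) h)" for h
    using U(4) U(2) by (rule continuous_on_subset)
  show "continuous_on (closure G) r"
    using diff by (meson continuous_at_imp_continuous_on differentiable_imp_continuous_within)
  show "continuous_on (closure G) (patch_normal r)"
    unfolding patch_normal_def[abs_def] by (intro continuous_on_cross cont)
qed

lemma smooth_patch_integrable:
  fixes f :: "real^3 \<Rightarrow> complex"
  assumes P: "smooth_patch (G, r)" and "continuous_on A f" "r ` closure G \<subseteq> A"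
  shows "set_integrable lborel G (\<lambda>u. f (r u) * complex_of_real (patch_normal r u $ m))"
proof (rule set_integrable_subset)
  have G: "open G" "bounded G"
    using P by (auto simp: smooth_patch_def)
  have "continuous_on (closure G) (\<lambda>u. f (r u))"
    using assms(2) smooth_patch_derivative(3)[OF P] assms(3) by (rule continuous_on_compose2)
  then show "set_integrable lborel (closure G) (\<lambda>u. f (r u) * complex_of_real (patch_normal r u $ m))"
    unfolding set_integrable_def using G(2) smooth_patch_derivative(4)[OF P]
    by (intro borel_integrable_compact continuous_intros) (auto simp: compact_closure)
  show "G \<in> sets lborel" "G \<subseteq> closure G"
    using G(1) closure_subset by auto
qed

lemma surface_integral_nth:
  "surface_integral S m f =
    (\<Sum>i<length S. LINT u:fst (S ! i)|lborel. f (snd (S ! i) u) * complex_of_real (patch_normal (snd (S ! i)) u $ m))"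
  unfolding surface_integral_def sum_list_sum_nth
  by (simp add: atLeast0LessThan split_beta)

text \<open>Each patch is pulled back along \<open>pair_of_vec2\<close>. This linear bijection sends
  the basis vectors to \<open>(1, 0)\<close> and \<open>(0, 1)\<close>, so the normals agree, and it
  preserves Lebesgue measure, so the surface integrals agree.\<close>

lemma divergence_theorem_real:
  fixes f D :: "real^3 \<Rightarrow> real"
  assumes "open \<Omega>" "bounded \<Omega>" and bd: "outward_piecewise_smooth_boundary \<Omega> S"
    and contf: "continuous_on (closure \<Omega>) f" and contD: "continuous_on (closure \<Omega>) D"
    and partial: "\<And>p. p \<in> \<Omega> \<Longrightarrow> ((\<lambda>t. f (p + t *\<^sub>R axis m 1)) has_vector_derivative D p) (at 0)"
  shows "(LINT p:\<Omega>|lborel. D p) =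
    (\<Sum>i<length S. LINT u:fst (S ! i)|lborel. f (snd (S ! i) u) * patch_normal (snd (S ! i)) u $ m)"
proof -
  let ?Q = pair_of_vec2
  define G r where "G i = fst (S ! i)" and "r i = snd (S ! i)" for i
  have Si: "S ! i = (G i, r i)" for i by (simp add: G_def r_def)
  have patch: "smooth_patch (G i, r i)" if "i < length S" for i
    using bd that unfolding outward_piecewise_smooth_boundary_def piecewise_smooth_surface_def
    by (metis Si nth_mem)
  have Glem: "open (G i)" "bounded (G i)" "negligible (frontier (G i))"
    "\<And>u. u \<in> G i \<Longrightarrow> patch_normal (r i) u \<noteq> 0" if "i < length S" for i
    using patch[OF that] by (auto simp: smooth_patch_def)
  have Qlin: "bounded_linear ?Q"
    using linear_pair_of_vec2 by (simp add: linear_conv_bounded_linear)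
  have Qinj: "inj ?Q" and Qsurj: "surj ?Q"
    using bij_pair_of_vec2 by (auto simp: bij_def)
  note invlin = linear_vec2_of_pair
  have vimage: "?Q -` A = vec2_of_pair ` A" for A
  proof (intro equalityI subsetI)
    fix v assume "v \<in> ?Q -` A"
    then show "v \<in> vec2_of_pair ` A"
      by (intro image_eqI[of _ _ "?Q v"]) (simp_all add: pair_of_vec2_inverse)
  qed (auto simp: pair_of_vec2_inverse)
  have cl: "closure (?Q -` A) = ?Q -` closure A" for A
    unfolding vimage using invlin pair_of_vec2_inverse(1)
    by (intro closure_injective_linear_image[symmetric] inj_on_inverseI)
  have contQ: "continuous_on A ?Q" for A
    using Qlin by (rule linear_continuous_on)
  have Q1: "?Q (axis 1 1) = (1, 0)" "?Q (axis 2 1) = (0, 1)"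
    by (simp_all add: pair_of_vec2_def axis_def)
  have normal: "cross3 (frechet_derivative (r i) (at (?Q u)) (?Q (axis 1 1))) (frechet_derivative (r i) (at (?Q u)) (?Q (axis 2 1)))
      = patch_normal (r i) (?Q u)" for i u
    by (simp add: Q1 patch_normal_def)
  have closed_under: "r i ` closure (G i) \<subseteq> closure \<Omega>" if "i < length S" for i
  proof -
    have "r i ` closure (G i) \<subseteq> surface_points S"
      unfolding surface_points_def using nth_mem[OF that] Si[of i] by fastforce
    then show ?thesis
      using bd by (auto simp: outward_piecewise_smooth_boundary_def closure_Un_frontier)
  qed
  have "(LINT p:\<Omega>|lborel. D p) = (\<Sum>i<length S. LINT u:?Q -` G i|lborel. f ((r i \<circ> ?Q) u) *
      cross3 (frechet_derivative (r i) (at (?Q u)) (?Q (axis 1 1))) (frechet_derivative (r i) (at (?Q u)) (?Q (axis 2 1))) $ m)"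
  proof (rule divergence_theorem_component[where r' = "\<lambda>i u h. frechet_derivative (r i) (at (?Q u)) (?Q h)",
        OF assms(1,2) _ _ _ _ _ _ _ _ _ contf contD partial], unfold cl normal)
    fix i assume i: "i < length S"
    show "open (?Q -` G i)"
      using Glem(1)[OF i] contQ by (rule open_vimage)
    show "bounded (?Q -` G i)"
      unfolding vimage using Glem(2)[OF i] invlin
      by (intro bounded_linear_image) (simp_all add: linear_conv_bounded_linear)
    have "?Q -` closure (G i) - ?Q -` G i = vec2_of_pair ` frontier (G i)"
      using Glem(1)[OF i] by (simp add: vimage[symmetric] frontier_def interior_open vimage_Diff)
    moreover have "negligible (vec2_of_pair ` frontier (G i))"
      using Glem(3)[OF i] invlin
      by (intro negligible_differentiable_image_negligible bounded_linear_imp_differentiable_on)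
        (auto simp: linear_conv_bounded_linear)
    ultimately show "negligible (?Q -` closure (G i) - ?Q -` G i)"
      by simp
    show "continuous_on (?Q -` closure (G i)) (\<lambda>u. frechet_derivative (r i) (at (?Q u)) (?Q h))" for h
      by (rule continuous_on_compose2[OF smooth_patch_derivative(2)[OF patch[OF i]] contQ]) auto
    fix u
    show "(r i \<circ> ?Q has_derivative (\<lambda>h. frechet_derivative (r i) (at (?Q u)) (?Q h))) (at u)" if "u \<in> ?Q -` closure (G i)"
      using diff_chain_at[OF bounded_linear_imp_has_derivative[OF Qlin] smooth_patch_derivative(1)[OF patch[OF i]]] that
      by (simp add: o_def)
    assume u: "u \<in> ?Q -` G i"
    then show "patch_normal (r i) (?Q u) \<noteq> 0"
      using Glem(4)[OF i] by simp
    have "(G i, r i) \<in> set S" using nth_mem[OF i] Si[of i] by simp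
    then show "\<forall>\<^sub>F t in at_right 0. (r i \<circ> ?Q) u + t *\<^sub>R patch_normal (r i) (?Q u) \<notin> closure \<Omega> \<and>
        (r i \<circ> ?Q) u - t *\<^sub>R patch_normal (r i) (?Q u) \<in> \<Omega>"
      using bd u unfolding outward_piecewise_smooth_boundary_def by fastforce
    fix j v assume j: "j < length S" and v: "v \<in> ?Q -` closure (G j)" and eq: "(r i \<circ> ?Q) u = (r j \<circ> ?Q) v"
    have "i = j \<and> ?Q u = ?Q v"
      using bd i j u v eq unfolding outward_piecewise_smooth_boundary_def piecewise_smooth_surface_def G_def r_def
      by auto
    then show "i = j \<and> u = v"
      using Qinj by (auto dest: injD)
  next
    have "surface_points S = (\<Union>i<length S. r i ` closure (G i))"
      unfolding surface_points_def set_conv_nth using Si by (fastforce simp: Si)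
    also have "\<dots> = (\<Union>i<length S. (r i \<circ> ?Q) ` (?Q -` closure (G i)))"
      by (simp only: image_comp[symmetric] surj_image_vimage_eq[OF Qsurj])
    finally show "frontier \<Omega> = (\<Union>i<length S. (r i \<circ> ?Q) ` (?Q -` closure (G i)))"
      using bd by (simp add: outward_piecewise_smooth_boundary_def)
  qed
  also have "\<dots> = (\<Sum>i<length S. LINT u:G i|lborel. f (r i u) * patch_normal (r i) u $ m)"
  proof (intro sum.cong refl)
    fix i assume "i \<in> {..<length S}"
    then have i: "i < length S" by simp
    let ?h = "\<lambda>u. f (r i u) * patch_normal (r i) u $ m"
    have "continuous_on (closure (G i)) (\<lambda>u. f (r i u))"
      using contf smooth_patch_derivative(3)[OF patch[OF i]] closed_under[OF i] by (rule continuous_on_compose2)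
    then have "continuous_on (closure (G i)) ?h"
      using smooth_patch_derivative(4)[OF patch[OF i]] by (intro continuous_intros)
    then have "continuous_on (G i) ?h"
      using closure_subset by (rule continuous_on_subset)
    then have meas: "(\<lambda>u. indicator (G i) u *\<^sub>R ?h u) \<in> borel_measurable borel"
      using Glem(1)[OF i] by (intro borel_measurable_continuous_on_indicator) auto
    have measQ: "?Q \<in> lborel \<rightarrow>\<^sub>M borel"
      using contQ by (simp add: borel_measurable_continuous_onI)
    have "(LINT u:?Q -` G i|lborel. ?h (?Q u)) = (LINT u|lborel. indicator (G i) (?Q u) *\<^sub>R ?h (?Q u))"
      unfolding set_lebesgue_integral_def by (simp add: indicator_vimage o_def)
    also have "\<dots> = integral\<^sup>L (distr lborel borel ?Q) (\<lambda>u. indicator (G i) u *\<^sub>R ?h u)"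
      using measQ meas by (rule integral_distr[symmetric])
    also have "\<dots> = (LINT u:G i|lborel. ?h u)"
      by (simp add: distr_pair_of_vec2 set_lebesgue_integral_def)
    finally show "(LINT u:?Q -` G i|lborel. f ((r i \<circ> ?Q) u) *
      cross3 (frechet_derivative (r i) (at (?Q u)) (?Q (axis 1 1))) (frechet_derivative (r i) (at (?Q u)) (?Q (axis 2 1))) $ m)
      = (LINT u:G i|lborel. ?h u)"
      by (simp add: normal)
  qed
  finally show ?thesis by (simp add: G_def r_def)
qed

section \<open>Complex-valued integrands\<close>

lemma set_integral_bounded_linear:
  fixes L :: "'a::{banach, second_countable_topology} \<Rightarrow> 'b::{banach, second_countable_topology}"
  assumes L: "bounded_linear L" and h: "set_integrable M A h"
  shows "(LINT x:A|M. L (h x)) = L (LINT x:A|M. h x)"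
proof -
  interpret bounded_linear L by fact
  have "(LINT x|M. L (indicator A x *\<^sub>R h x)) = L (LINT x|M. indicator A x *\<^sub>R h x)"
    using L h unfolding set_integrable_def by (rule integral_bounded_linear)
  then show ?thesis
    by (simp add: set_lebesgue_integral_def scaleR)
qed

theorem divergence_theorem_complex:
  fixes f D :: "real^3 \<Rightarrow> complex"
  assumes "open \<Omega>" "bounded \<Omega>" and bd: "outward_piecewise_smooth_boundary \<Omega> S"
    and contf: "continuous_on (closure \<Omega>) f" and contD: "continuous_on (closure \<Omega>) D"
    and partial: "\<And>p. p \<in> \<Omega> \<Longrightarrow> ((\<lambda>t. f (p + t *\<^sub>R axis m 1)) has_vector_derivative D p) (at 0)"
  shows "(LINT p:\<Omega>|lborel. D p) = surface_integral S m f"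
proof -
  have patch: "set_integrable lborel (fst (S ! i))
      (\<lambda>u. f (snd (S ! i) u) * complex_of_real (patch_normal (snd (S ! i)) u $ m))" if "i < length S" for i
  proof (rule smooth_patch_integrable[OF _ contf])
    show "smooth_patch (fst (S ! i), snd (S ! i))"
      using bd that by (simp add: outward_piecewise_smooth_boundary_def piecewise_smooth_surface_def)
    have "snd (S ! i) ` closure (fst (S ! i)) \<subseteq> surface_points S"
      unfolding surface_points_def using nth_mem[OF that] by (fastforce simp: split_beta)
    then show "snd (S ! i) ` closure (fst (S ! i)) \<subseteq> closure \<Omega>"
      using bd by (auto simp: outward_piecewise_smooth_boundary_def closure_Un_frontier)
  qed
  have D: "set_integrable lborel \<Omega> D"
  proof (rule set_integrable_subset)
    show "set_integrable lborel (closure \<Omega>) D"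
      unfolding set_integrable_def using \<open>bounded \<Omega>\<close> contD
      by (intro borel_integrable_compact) (auto simp: compact_closure)
  qed (use \<open>open \<Omega>\<close> closure_subset in auto)
  \<comment> \<open>\<open>L\<close> stands for the real or the imaginary part; the components of
    the normal are real and can be taken out of it.\<close>
  have part: "L (LINT p:\<Omega>|lborel. D p) = L (surface_integral S m f)"
    if L: "bounded_linear L" and L_real: "\<And>z t. L (z * complex_of_real t) = L z * t" for L :: "complex \<Rightarrow> real"
  proof -
    interpret L: bounded_linear L by fact
    have "L (LINT p:\<Omega>|lborel. D p) = (LINT p:\<Omega>|lborel. L (D p))"
      by (rule set_integral_bounded_linear[OF L D, symmetric])
    also have "\<dots> = (\<Sum>i<length S. LINT u:fst (S ! i)|lborel. L (f (snd (S ! i) u)) * patch_normal (snd (S ! i)) u $ m)"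
      using assms(1,2) bd
      by (rule divergence_theorem_real)
        (use contf contD partial in \<open>auto intro: L.continuous_on L.has_vector_derivative\<close>)
    also have "\<dots> = L (surface_integral S m f)"
      unfolding surface_integral_nth L.sum using set_integral_bounded_linear[OF L patch, symmetric] by (simp add: L_real)
    finally show ?thesis .
  qed
  show ?thesis
  proof (rule complex_eqI)
    show "Re (LINT p:\<Omega>|lborel. D p) = Re (surface_integral S m f)"
      by (rule part[OF bounded_linear_Re]) simp
    show "Im (LINT p:\<Omega>|lborel. D p) = Im (surface_integral S m f)"
      by (rule part[OF bounded_linear_Im]) simp
  qed
qed

section \<open>Monogenic mappings\<close>

lemma bounded_linear_ecoord: "bounded_linear (ecoord k)"
proof (rule bounded_linear_intro[where K = 2])
  have comp: "norm (q0 x) \<le> norm x" "norm (q1 x) \<le> norm x" "norm (q2 x) \<le> norm x" "norm (q3 x) \<le> norm x" for x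
    unfolding norm_cquat_def by (meson norm_fst_le norm_snd_le order_trans)+
  show "norm (ecoord k x) \<le> norm x * 2" for x
  proof -
    have "norm (ecoord k x) \<le> norm (q0 x) + norm (q1 x) \<or> norm (ecoord k x) \<le> norm (q2 x) + norm (q3 x)"
      unfolding ecoord_def
      using norm_triangle_ineq4[of "q0 x" "\<i> * q1 x"] norm_triangle_ineq[of "q0 x" "\<i> * q1 x"]
        norm_triangle_ineq4[of "- \<i> * q2 x" "q3 x"] norm_triangle_ineq[of "- \<i> * q2 x" "q3 x"]
      by (simp add: norm_mult)
    then show ?thesis using comp[of x] by linarith
  qed
qed (simp_all add: ecoord_def cquat_defs algebra_simps scaleR_conv_of_real)

text \<open>\<open>zeta\<close> is linear, so the Gateaux quotient is the difference quotient of the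
  partial derivative, with the limit taken from the right only. It must agree with the two-sided
  limit \<open>d\<close>.\<close>

lemma G_derivative_axis:
  assumes "((\<lambda>t. F (zeta i2 i3 (p + t *\<^sub>R axis m 1))) has_vector_derivative d) (at 0)"
    and "((\<lambda>\<epsilon>. inverse \<epsilon> *\<^sub>R (F (zeta i2 i3 p + \<epsilon> *\<^sub>R zeta i2 i3 (axis m 1)) - F (zeta i2 i3 p))) \<longlongrightarrow> d') (at_right 0)"
  shows "d = d'"
proof -
  have z: "zeta i2 i3 (p + t *\<^sub>R axis m 1) = zeta i2 i3 p + t *\<^sub>R zeta i2 i3 (axis m 1)" for t
    by (simp add: zeta_def algebra_simps)
  let ?q = "\<lambda>t. inverse t *\<^sub>R (F (zeta i2 i3 p + t *\<^sub>R zeta i2 i3 (axis m 1)) - F (zeta i2 i3 p))"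
  have "((\<lambda>t. norm (F (zeta i2 i3 p + t *\<^sub>R zeta i2 i3 (axis m 1)) - F (zeta i2 i3 p) - t *\<^sub>R d) / norm t) \<longlongrightarrow> 0) (at 0)"
    using assms(1) unfolding has_vector_derivative_def has_derivative_at by (simp add: z)
  then have "((\<lambda>t. norm (?q t - d)) \<longlongrightarrow> 0) (at 0)"
  proof (rule Lim_transform_eventually)
    have "norm (x - t *\<^sub>R d) / norm t = norm (inverse t *\<^sub>R x - d)" if "t \<noteq> 0" for x and t :: real
    proof -
      have "inverse t *\<^sub>R x - d = inverse t *\<^sub>R (x - t *\<^sub>R d)"
        using that by (simp add: scaleR_diff_right)
      then show ?thesis by (simp add: divide_inverse mult.commute)
    qed
    then show "\<forall>\<^sub>F t in at 0. norm (F (zeta i2 i3 p + t *\<^sub>R zeta i2 i3 (axis m 1)) - F (zeta i2 i3 p) - t *\<^sub>R d) / norm t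
        = norm (?q t - d)"
      by (auto simp: eventually_at_filter)
  qed
  then have "(?q \<longlongrightarrow> d) (at 0)"
    by (rule LIM_zero_cancel[OF tendsto_norm_zero_cancel])
  then have "(?q \<longlongrightarrow> d) (at_right 0)"
    by (rule filterlim_mono) (simp_all add: at_le)
  then show ?thesis
    using assms(2) by (rule tendsto_unique[OF trivial_limit_at_right_real])
qed

text \<open>The continuous extension of the partial derivative to the closure comes from
  \<open>C1\<close>. Inside \<open>\<Omega>\<close> it equals the Gateaux limit \<open>d p\<close>,
  and the volume integral sees only \<open>\<Omega>\<close>.\<close>

lemma surface_integral_ecoord:
  assumes "open \<Omega>" "bounded \<Omega>" "outward_piecewise_smooth_boundary \<Omega> S"
    and C1: "C1_up_to_boundary \<Omega> (\<lambda>p. F (zeta i2 i3 p))"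
    and lim: "\<And>p. p \<in> \<Omega> \<Longrightarrow> ((\<lambda>\<epsilon>. inverse \<epsilon> *\<^sub>R
      (F (zeta i2 i3 p + \<epsilon> *\<^sub>R zeta i2 i3 (axis m 1)) - F (zeta i2 i3 p))) \<longlongrightarrow> d p) (at_right 0)"
  shows "surface_integral S m (\<lambda>p. ecoord k (F (zeta i2 i3 p))) = (LINT p:\<Omega>|lborel. ecoord k (d p))"
proof -
  obtain D where D: "continuous_on (closure \<Omega>) D"
    "\<And>p. p \<in> \<Omega> \<Longrightarrow> ((\<lambda>t. F (zeta i2 i3 (p + t *\<^sub>R axis m 1))) has_vector_derivative D p) (at 0)"
    using C1 unfolding C1_up_to_boundary_def by blast
  have "(LINT p:\<Omega>|lborel. ecoord k (D p)) = surface_integral S m (\<lambda>p. ecoord k (F (zeta i2 i3 p)))"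
    using assms(1-3)
  proof (rule divergence_theorem_complex)
    show "continuous_on (closure \<Omega>) (\<lambda>p. ecoord k (F (zeta i2 i3 p)))"
      using C1 by (intro bounded_linear.continuous_on[OF bounded_linear_ecoord])
        (simp add: C1_up_to_boundary_def)
    show "continuous_on (closure \<Omega>) (\<lambda>p. ecoord k (D p))"
      using D(1) by (rule bounded_linear.continuous_on[OF bounded_linear_ecoord])
    show "((\<lambda>t. ecoord k (F (zeta i2 i3 (p + t *\<^sub>R axis m 1)))) has_vector_derivative ecoord k (D p)) (at 0)"
      if "p \<in> \<Omega>" for p
      using D(2)[OF that] by (rule bounded_linear.has_vector_derivative[OF bounded_linear_ecoord])
  qed
  moreover have "D p = d p" if "p \<in> \<Omega>" for p
    using D(2)[OF that] lim[OF that] by (rule G_derivative_axis)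
  then have "(LINT p:\<Omega>|lborel. ecoord k (D p)) = (LINT p:\<Omega>|lborel. ecoord k (d p))"
    using \<open>open \<Omega>\<close> by (intro set_lebesgue_integral_cong) auto
  ultimately show ?thesis by simp
qed

text \<open>Left multiplication by \<open>e1\<close> fixes \<open>e1\<close>, \<open>e3\<close> and
  kills \<open>e2\<close>, \<open>e4\<close>; for \<open>e2\<close> it is the other way round.
  \<open>ecoord\<close> and \<open>ebasis\<close> both read an index outside 1..4 as 4, so the
  identities hold for every \<open>k\<close>.\<close>

lemma ecoord_diagonal_left:
  "ecoord k ((a *\<^sub>C e1 + b *\<^sub>C e2) * x) = (if k = 1 \<or> k = 3 then a else b) * ecoord k x"
  "(a *\<^sub>C e1 + b *\<^sub>C e2) * ebasis k = (if k = 1 \<or> k = 3 then a else b) *\<^sub>C ebasis k"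
  by (auto simp: ecoord_def ebasis_def e1_def e2_def e3_def e4_def cquat_defs field_simps)

text \<open>On the right the basis is grouped differently: \<open>e1\<close> fixes \<open>e1\<close>
  and \<open>e4\<close>, while \<open>e2\<close> fixes \<open>e2\<close> and
  \<open>e3\<close>.\<close>

lemma ecoord_diagonal_right:
  "ecoord k (x * (a *\<^sub>C e1 + b *\<^sub>C e2)) = (if k = 2 \<or> k = 3 then b else a) * ecoord k x"
  "ebasis k * (a *\<^sub>C e1 + b *\<^sub>C e2) = (if k = 2 \<or> k = 3 then b else a) *\<^sub>C ebasis k"
  by (auto simp: ecoord_def ebasis_def e1_def e2_def e3_def e4_def cquat_defs field_simps)

text \<open>\<open>e1\<close> and \<open>e2\<close> are idempotents with
  \<open>e1 * e2 = e2 * e1 = 0\<close> and sum 1.\<close>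

lemma one_plus_squares_diagonal:
  "1 + (a1 *\<^sub>C e1 + a2 *\<^sub>C e2)\<^sup>2 + (b1 *\<^sub>C e1 + b2 *\<^sub>C e2)\<^sup>2 =
    (1 + a1\<^sup>2 + b1\<^sup>2) *\<^sub>C e1 + (1 + a2\<^sup>2 + b2\<^sup>2) *\<^sub>C e2"
  by (simp add: power2_eq_square e1_def e2_def cquat_defs field_simps)

lemma zeta_axis: "zeta i2 i3 (axis 1 1) = 1" "zeta i2 i3 (axis 2 1) = i2" "zeta i2 i3 (axis 3 1) = i3"
  by (simp_all add: zeta_def axis_def)

text \<open>One factor \<open>u\<close> comes from the partial derivative, the other from the
  coefficient of the form \<sigma>; together they make the square. The same holds for
  \<open>v\<close>.\<close>

lemma cscale_combine:
  "c *\<^sub>C x + (u * c) *\<^sub>C (u *\<^sub>C x) + (v * c) *\<^sub>C (v *\<^sub>C x) = ((1 + u\<^sup>2 + v\<^sup>2) * c) *\<^sub>C x"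
  by (simp add: cscale_def plus_cquat_def power2_eq_square algebra_simps)

theorem theorem4:
  fixes a1 a2 b1 b2 :: complex
    and i2 i3 :: cquat
    and \<Omega> :: "(real^3) set"
    and S :: "patch list"
    and \<Phi> \<Phi>h :: "cquat \<Rightarrow> cquat"
  assumes "i2 = a1 *\<^sub>C e1 + a2 *\<^sub>C e2"
    and "i3 = b1 *\<^sub>C e1 + b2 *\<^sub>C e2"
    and "distinct [1, i2, i3]" and "independent {1, i2, i3}"
    and "f1 ` E3 i2 i3 = UNIV" and "f2 ` E3 i2 i3 = UNIV"
    and "open \<Omega>" and "connected \<Omega>" and "\<Omega> \<noteq> {}" and "bounded \<Omega>"
    and "outward_piecewise_smooth_boundary \<Omega> S"
    and "right_G_monogenic_on i2 i3 \<Phi> (zeta i2 i3 ` \<Omega>)"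
    and "left_G_monogenic_on i2 i3 \<Phi>h (zeta i2 i3 ` \<Omega>)"
    and "C1_up_to_boundary \<Omega> (\<lambda>p. \<Phi> (zeta i2 i3 p))"
    and "C1_up_to_boundary \<Omega> (\<lambda>p. \<Phi>h (zeta i2 i3 p))"
  shows "sigma_left_integral i2 i3 S \<Phi> =
      volume_integral i2 i3 \<Omega> (\<lambda>\<zeta>. (1 + i2\<^sup>2 + i3\<^sup>2) * right_G_deriv i2 i3 \<Phi> \<zeta>)
    \<and> sigma_right_integral i2 i3 S \<Phi>h =
      volume_integral i2 i3 \<Omega> (\<lambda>\<zeta>. left_G_deriv i2 i3 \<Phi>h \<zeta> * (1 + i2\<^sup>2 + i3\<^sup>2))"
proof -
  note i2 = assms(1) and i3 = assms(2) and \<Omega> = \<open>open \<Omega>\<close> \<open>bounded \<Omega>\<close> assms(11)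
  have unit: "zeta i2 i3 (axis m 1) \<in> E3 i2 i3" for m
    by (simp add: E3_def)
  \<comment> \<open>The partial derivative in direction \<open>m\<close> is the Gateaux derivative
    along \<open>zeta i2 i3 (axis m 1)\<close>, which is 1, \<open>i2\<close>, \<open>i3\<close> in
    turn.\<close>
  have R: "surface_integral S m (\<lambda>p. ecoord k (\<Phi> (zeta i2 i3 p))) =
      (LINT p:\<Omega>|lborel. ecoord k (zeta i2 i3 (axis m 1) * right_G_deriv i2 i3 \<Phi> (zeta i2 i3 p)))" for m k
  proof (rule surface_integral_ecoord[OF \<Omega> assms(14)])
    fix p assume "p \<in> \<Omega>"
    then obtain D where D: "has_right_G_derivative i2 i3 \<Phi> D (zeta i2 i3 p)"
      using assms(12) unfolding right_G_monogenic_on_def by blast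
    show "((\<lambda>\<epsilon>. inverse \<epsilon> *\<^sub>R (\<Phi> (zeta i2 i3 p + \<epsilon> *\<^sub>R zeta i2 i3 (axis m 1)) - \<Phi> (zeta i2 i3 p)))
        \<longlongrightarrow> zeta i2 i3 (axis m 1) * right_G_deriv i2 i3 \<Phi> (zeta i2 i3 p)) (at_right 0)"
      unfolding right_G_deriv_eq[OF D] using D unit unfolding has_right_G_derivative_def by blast
  qed
  have L: "surface_integral S m (\<lambda>p. ecoord k (\<Phi>h (zeta i2 i3 p))) =
      (LINT p:\<Omega>|lborel. ecoord k (left_G_deriv i2 i3 \<Phi>h (zeta i2 i3 p) * zeta i2 i3 (axis m 1)))" for m k
  proof (rule surface_integral_ecoord[OF \<Omega> assms(15)])
    fix p assume "p \<in> \<Omega>"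
    then obtain D where D: "has_left_G_derivative i2 i3 \<Phi>h D (zeta i2 i3 p)"
      using assms(13) unfolding left_G_monogenic_on_def by blast
    show "((\<lambda>\<epsilon>. inverse \<epsilon> *\<^sub>R (\<Phi>h (zeta i2 i3 p + \<epsilon> *\<^sub>R zeta i2 i3 (axis m 1)) - \<Phi>h (zeta i2 i3 p)))
        \<longlongrightarrow> left_G_deriv i2 i3 \<Phi>h (zeta i2 i3 p) * zeta i2 i3 (axis m 1)) (at_right 0)"
      unfolding left_G_deriv_eq[OF D] using D unit unfolding has_left_G_derivative_def by blast
  qed
  have "sigma_left_integral i2 i3 S \<Phi> =
      volume_integral i2 i3 \<Omega> (\<lambda>\<zeta>. (1 + i2\<^sup>2 + i3\<^sup>2) * right_G_deriv i2 i3 \<Phi> \<zeta>)"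
    unfolding sigma_left_integral_def volume_integral_def R zeta_axis mult_1
    \<comment> \<open>In the basis \<open>e1\<close>, ..., \<open>e4\<close> the factors become
      scalars that leave the integrals, so the two sides can be compared for each \<open>k\<close>
      separately.\<close>
    unfolding i2 i3 one_plus_squares_diagonal ecoord_diagonal_left set_integral_mult_right
    by (intro sum.cong refl trans[OF cscale_combine]) auto
  moreover have "sigma_right_integral i2 i3 S \<Phi>h =
      volume_integral i2 i3 \<Omega> (\<lambda>\<zeta>. left_G_deriv i2 i3 \<Phi>h \<zeta> * (1 + i2\<^sup>2 + i3\<^sup>2))"
    unfolding sigma_right_integral_def volume_integral_def L zeta_axis mult_1_right
    unfolding i2 i3 one_plus_squares_diagonal ecoord_diagonal_right set_integral_mult_right
    by (intro sum.cong refl trans[OF cscale_combine]) auto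
  ultimately show ?thesis by blast
qed

end
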